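(* The Basilica group $B$, as a self-similar group over $X=\{0,1\}$, has a simple Nekrashevych algebra $\mathcal N_K(B,\{0,1\})$ over every field $K$.
   Context: For a finite alphabet $X$ with $|X|\ge2$, $X^*$ is the free monoid on $X$. A self-similar group over $X$ is a group $G$ with a faithful action on $X^*$ by length-preserving permutations such that for all $g\in G$, $x\in X$ there is $g|_x\in G$ (the section) with $g(xw)=g(x)\,g|_x(w)$ for all $w\in X^*$. The Basilica group $B$ is the group of permutations of $\{0,1\}^*$ generated by $a$ and $c$, which fix the empty word and are given recursively by $a(0w)=0w$, $a(1w)=1c(w)$, $c(0w)=1w$, $c(1w)=0a(w)$ for $w\in\{0,1\}^*$. It is self-similar. For a self-similar group $G$ over $X$ and a field $K$, the Nekrashevych algebra $\mathcal N_K(G,X)$ is the $*$-algebra over $K$ (with $K$-linear involution satisfying $(ab)^*=b^*a^*$) generated by $X\cup G$ with relations: $g^*=g^{-1}$ and $g\cdot h=gh$ for $g,h\in G$; $gx=g(x)g|_x$ for $g\in G$, $x\in X$; $y^*x=\delta_{x,y}$ for $x,y\in X$; $\sum_{x\in X}xx^*=1$. Simple means nonzero with no two-sided ideals other than $0$ and itself. *)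

theory Defs
  imports "HOL-Algebra.Algebra" "HOL-Library.Poly_Mapping"
begin

section \<open>Self-similar groups\<close>

text \<open>The alphabet is the whole of a finite type, so the free monoid on it is the type of lists.
  Multiplication in \<^term>\<open>BijGroup UNIV\<close> is composition, so this is a left action.\<close>

locale self_similar_group = faithful_action G "UNIV :: 'x::finite list set" \<phi>
  for G (structure) and \<phi> :: "'g \<Rightarrow> 'x::finite list \<Rightarrow> 'x list" +
  assumes alphabet: "card (UNIV :: 'x set) \<ge> 2"
    and length_preserving: "g \<in> carrier G \<Longrightarrow> length (\<phi> g w) = length w"
    and ex_section:
      "g \<in> carrier G \<Longrightarrow> \<exists>h \<in> carrier G. \<forall>w. \<phi> g (x # w) = hd (\<phi> g [x]) # \<phi> h w"

definition act_letter :: "('g \<Rightarrow> 'x list \<Rightarrow> 'x list) \<Rightarrow> 'g \<Rightarrow> 'x \<Rightarrow> 'x" where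
  "act_letter \<phi> g x = hd (\<phi> g [x])"

text \<open>In a self-similar group the section exists by assumption and is unique by faithfulness.\<close>

definition section_at ::
    "('g, 'm) monoid_scheme \<Rightarrow> ('g \<Rightarrow> 'x list \<Rightarrow> 'x list) \<Rightarrow> 'g \<Rightarrow> 'x \<Rightarrow> 'g" where
  "section_at G \<phi> g x =
     (THE h. h \<in> carrier G \<and> (\<forall>w. \<phi> g (x # w) = act_letter \<phi> g x # \<phi> h w))"

lemma (in self_similar_group) section_at:
  assumes "g \<in> carrier G"
  shows "section_at G \<phi> g x \<in> carrier G"
    and "\<phi> g (x # w) = act_letter \<phi> g x # \<phi> (section_at G \<phi> g x) w"
proof -
  let ?P = "\<lambda>h. h \<in> carrier G \<and> (\<forall>w. \<phi> g (x # w) = act_letter \<phi> g x # \<phi> h w)"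
  obtain h where h: "?P h"
    using ex_section[OF assms, of x] by (auto simp: act_letter_def)
  have "h' = h" if "?P h'" for h'
  proof -
    have "\<phi> h' = \<phi> h" using h that by (metis ext list.inject)
    then show ?thesis using h that faithful by (auto dest: inj_onD)
  qed
  with h have "?P (section_at G \<phi> g x)"
    unfolding section_at_def by (rule theI2)
  then show "section_at G \<phi> g x \<in> carrier G"
    "\<phi> g (x # w) = act_letter \<phi> g x # \<phi> (section_at G \<phi> g x) w" by auto
qed

section \<open>Free unital star-algebras\<close>

datatype 'a free_monoid = Word (letters: "'a list")

instantiation free_monoid :: (type) monoid_add
begin
definition zero_free_monoid :: "'a free_monoid" where "0 = Word []"
definition plus_free_monoid :: "'a free_monoid \<Rightarrow> 'a free_monoid \<Rightarrow> 'a free_monoid" where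
  "u + v = Word (letters u @ letters v)"
instance by standard (auto simp: zero_free_monoid_def plus_free_monoid_def)
end

text \<open>The free unital star-algebra on a set S is the algebra of noncommutative polynomials in the
  elements of S and their formal adjoints, that is, the monoid algebra of the free monoid on them.\<close>

datatype 'a gen = Gen 'a | Adj 'a

type_synonym ('a, 'k) nc_poly = "'a gen free_monoid \<Rightarrow>\<^sub>0 'k"

fun gen_base :: "'a gen \<Rightarrow> 'a" where
  "gen_base (Gen a) = a"
| "gen_base (Adj a) = a"

fun gen_adj :: "'a gen \<Rightarrow> 'a gen" where
  "gen_adj (Gen a) = Adj a"
| "gen_adj (Adj a) = Gen a"

definition word_adj :: "'a gen free_monoid \<Rightarrow> 'a gen free_monoid" where
  "word_adj w = Word (rev (map gen_adj (letters w)))"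

text \<open>The involution is \<open>K\<close>-linear; scalars are not conjugated.\<close>

definition adj :: "('a, 'k::field) nc_poly \<Rightarrow> ('a, 'k) nc_poly" where
  "adj p = (\<Sum>w \<in> Poly_Mapping.keys p. Poly_Mapping.single (word_adj w) (Poly_Mapping.lookup p w))"

definition gen :: "'a \<Rightarrow> ('a, 'k::field) nc_poly" where
  "gen a = Poly_Mapping.single (Word [Gen a]) 1"

definition free_star_algebra :: "'a set \<Rightarrow> ('a, 'k::field) nc_poly ring" where
  "free_star_algebra S =
     \<lparr>carrier = {p. \<forall>w \<in> Poly_Mapping.keys p. gen_base ` set (letters w) \<subseteq> S},
      monoid.mult = (*), monoid.one = 1, ring.zero = 0, ring.add = (+)\<rparr>"

text \<open>The ideal by which one divides to impose the relations \<open>r = 0\<close> for \<open>r\<close> in \<open>Rel\<close>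
  on a star-algebra.\<close>

definition star_ideal ::
    "'a set \<Rightarrow> ('a, 'k::field) nc_poly set \<Rightarrow> ('a, 'k) nc_poly set" where
  "star_ideal S Rel =
     \<Inter>{I. ideal I (free_star_algebra S) \<and> Rel \<subseteq> I \<and> adj ` I \<subseteq> I}"

lemma word_adj_invol [simp]: "word_adj (word_adj w) = w"
proof -
  have "gen_adj \<circ> gen_adj = (id :: 'a gen \<Rightarrow> _)"
    by (rule ext) (metis gen_adj.elims gen_adj.simps comp_apply id_apply)
  then show ?thesis by (simp add: word_adj_def rev_map)
qed

lemma word_adj_plus: "word_adj (u + v) = word_adj v + word_adj u"
  by (simp add: word_adj_def plus_free_monoid_def)

lemma lookup_adj: "Poly_Mapping.lookup (adj p) w = Poly_Mapping.lookup p (word_adj w)"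
proof -
  have eq: "word_adj v = w \<longleftrightarrow> v = word_adj w" for v
    by (metis word_adj_invol)
  show ?thesis
    by (auto simp: adj_def lookup_sum lookup_single when_def eq in_keys_iff sum.delta)
qed

lemma adj_invol: "adj (adj p) = p"
  by (rule poly_mapping_eqI) (simp add: lookup_adj)

lemma adj_add: "adj (p + q) = adj p + adj q"
  by (rule poly_mapping_eqI) (simp add: lookup_adj lookup_add)

lemma adj_single: "adj (Poly_Mapping.single w c) = Poly_Mapping.single (word_adj w) c"
  by (auto simp: adj_def)

lemma adj_sum: "adj (sum f A) = (\<Sum>x \<in> A. adj (f x))"
  by (induction A rule: infinite_finite_induct) (auto simp: adj_add, simp_all add: adj_def)

lemma adj_mult: "adj (p * q) = adj q * adj p"
proof -
  have expand: "p = (\<Sum>w \<in> Poly_Mapping.keys p. Poly_Mapping.single w (Poly_Mapping.lookup p w))"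
    for p :: "('a, 'k::field) nc_poly"
    by (rule poly_mapping_eqI)
       (auto simp: lookup_sum lookup_single when_def sum.delta in_keys_iff)
  have "p * q = (\<Sum>v \<in> Poly_Mapping.keys q. \<Sum>u \<in> Poly_Mapping.keys p.
      Poly_Mapping.single (u + v) (Poly_Mapping.lookup p u * Poly_Mapping.lookup q v))"
    by (subst expand[of p], subst expand[of q])
       (simp add: sum_distrib_left sum_distrib_right mult_single)
  then show ?thesis
    by (simp add: adj_sum adj_single word_adj_plus adj_def[of p] adj_def[of q]
        sum_distrib_left sum_distrib_right mult_single mult.commute)
       (rule sum.swap)
qed

lemma free_star_algebra_simps [simp]:
  "p \<otimes>\<^bsub>free_star_algebra S\<^esub> q = p * q" "\<one>\<^bsub>free_star_algebra S\<^esub> = 1"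
  "p \<oplus>\<^bsub>free_star_algebra S\<^esub> q = p + q" "\<zero>\<^bsub>free_star_algebra S\<^esub> = 0"
  by (simp_all add: free_star_algebra_def)

lemma in_free_star_algebra_iff:
  "p \<in> carrier (free_star_algebra S)
     \<longleftrightarrow> Poly_Mapping.keys p \<subseteq> {w. gen_base ` set (letters w) \<subseteq> S}"
  by (auto simp: free_star_algebra_def)

lemma free_star_algebra_closed:
  fixes p q :: "('a, 'k::field) nc_poly"
  shows "(1 :: ('a, 'k) nc_poly) \<in> carrier (free_star_algebra S)"
    and "(0 :: ('a, 'k) nc_poly) \<in> carrier (free_star_algebra S)"
    and "p \<in> carrier (free_star_algebra S) \<Longrightarrow> - p \<in> carrier (free_star_algebra S)"
  by (simp_all add: in_free_star_algebra_iff zero_free_monoid_def)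

lemma free_star_algebra_closed2:
  fixes p q :: "('a, 'k::field) nc_poly"
  assumes p: "p \<in> carrier (free_star_algebra S)" and q: "q \<in> carrier (free_star_algebra S)"
  shows "p + q \<in> carrier (free_star_algebra S)"
    and "p - q \<in> carrier (free_star_algebra S)"
    and "p * q \<in> carrier (free_star_algebra S)"
proof -
  show "p + q \<in> carrier (free_star_algebra S)"
    using p q Poly_Mapping.keys_add[of p q] unfolding in_free_star_algebra_iff by blast
  show "p - q \<in> carrier (free_star_algebra S)"
    using p q Poly_Mapping.keys_diff[of p q] unfolding in_free_star_algebra_iff by blast
  have "gen_base ` set (letters (u + v)) \<subseteq> S"
    if "u \<in> Poly_Mapping.keys p" "v \<in> Poly_Mapping.keys q" for u v
  proof -
    have "gen_base ` set (letters u) \<subseteq> S" "gen_base ` set (letters v) \<subseteq> S"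
      using p q that unfolding in_free_star_algebra_iff by blast+
    then show ?thesis by (simp add: plus_free_monoid_def image_Un)
  qed
  then show "p * q \<in> carrier (free_star_algebra S)"
    using Poly_Mapping.keys_mult[of p q] unfolding in_free_star_algebra_iff by blast
qed

lemma ring_free_star_algebra: "ring (free_star_algebra S :: ('a, 'k::field) nc_poly ring)"
  (is "ring ?F")
proof (rule ringI)
  show "abelian_group ?F"
  proof (rule abelian_groupI)
    show "\<exists>y \<in> carrier ?F. y \<oplus>\<^bsub>?F\<^esub> p = \<zero>\<^bsub>?F\<^esub>" if "p \<in> carrier ?F" for p
      using free_star_algebra_closed(3)[OF that] by (intro bexI[of _ "- p"]) simp_all
  qed (simp_all add: free_star_algebra_closed free_star_algebra_closed2 algebra_simps)
  show "Group.monoid ?F"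
    by (rule monoidI) (simp_all add: free_star_algebra_closed free_star_algebra_closed2 mult.assoc)
qed (simp_all add: algebra_simps)

section \<open>Nekrashevych algebras\<close>

abbreviation letter_gen :: "'x \<Rightarrow> ('x + 'g, 'k::field) nc_poly" where
  "letter_gen x \<equiv> gen (Inl x)"

abbreviation group_gen :: "'g \<Rightarrow> ('x + 'g, 'k::field) nc_poly" where
  "group_gen g \<equiv> gen (Inr g)"

text \<open>A relation \<open>p = q\<close> is recorded as \<open>p - q\<close>.  The first relation expresses the usual
  convention that the symbol \<open>1\<close> denotes both the identity of \<open>G\<close> and the unit of the algebra.
  It does not follow from the others: sending every letter to \<open>(x, x)\<close> and every \<open>g\<close> to \<open>(g, 0)\<close>
  in the product of the Nekrashevych algebra and the Leavitt algebra satisfies those.\<close>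

definition nekrashevych_relations ::
    "('g, 'm) monoid_scheme \<Rightarrow> ('g \<Rightarrow> 'x::finite list \<Rightarrow> 'x list)
      \<Rightarrow> ('x + 'g, 'k::field) nc_poly set" where
  "nekrashevych_relations G \<phi> =
     {group_gen \<one>\<^bsub>G\<^esub> - 1}
     \<union> {adj (group_gen g) - group_gen (inv\<^bsub>G\<^esub> g) | g. g \<in> carrier G}
     \<union> {group_gen g * group_gen h - group_gen (g \<otimes>\<^bsub>G\<^esub> h)
          | g h. g \<in> carrier G \<and> h \<in> carrier G}
     \<union> {group_gen g * letter_gen x
          - letter_gen (act_letter \<phi> g x) * group_gen (section_at G \<phi> g x)
          | g x. g \<in> carrier G}
     \<union> {adj (letter_gen y) * letter_gen x - (if x = y then 1 else 0) | x y. True}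
     \<union> {(\<Sum>x \<in> UNIV. letter_gen x * adj (letter_gen x)) - 1}"

definition nekrashevych_generators ::
    "('g, 'm) monoid_scheme \<Rightarrow> ('x + 'g) set" where
  "nekrashevych_generators G = range Inl \<union> Inr ` carrier G"

text \<open>The first argument carries the coefficient field.\<close>

definition nekrashevych_algebra ::
    "'k::field itself \<Rightarrow> ('g, 'm) monoid_scheme \<Rightarrow> ('g \<Rightarrow> 'x::finite list \<Rightarrow> 'x list)
      \<Rightarrow> ('x + 'g, 'k) nc_poly set ring" where
  "nekrashevych_algebra K G \<phi> =
     free_star_algebra (nekrashevych_generators G) Quot
       star_ideal (nekrashevych_generators G) (nekrashevych_relations G \<phi>)"

lemma generators_in_carrier:
  "a \<in> S \<Longrightarrow> gen a \<in> carrier (free_star_algebra S)"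
  "p \<in> carrier (free_star_algebra S) \<Longrightarrow> adj p \<in> carrier (free_star_algebra S)"
proof -
  show "a \<in> S \<Longrightarrow> gen a \<in> carrier (free_star_algebra S)"
    by (simp add: gen_def free_star_algebra_def)
  have "gen_base (gen_adj x) = gen_base x" for x :: "'a gen" by (cases x) auto
  then have base: "gen_base ` set (letters (word_adj w)) = gen_base ` set (letters w)"
    for w :: "'a gen free_monoid" by (simp add: word_adj_def image_image)
  assume p: "p \<in> carrier (free_star_algebra S)"
  have "gen_base ` set (letters w) \<subseteq> S" if "w \<in> Poly_Mapping.keys (adj p)" for w
  proof -
    have "word_adj w \<in> Poly_Mapping.keys p"
      using that by (simp add: lookup_adj in_keys_iff)
    then have "gen_base ` set (letters (word_adj w)) \<subseteq> S"
      using p by (simp add: free_star_algebra_def)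
    then show ?thesis by (simp only: base)
  qed
  then show "adj p \<in> carrier (free_star_algebra S)"
    by (simp add: free_star_algebra_def)
qed

lemma ideal_star_ideal:
  assumes "Rel \<subseteq> carrier (free_star_algebra S)"
  shows "ideal (star_ideal S Rel) (free_star_algebra S)"
proof -
  interpret ring "free_star_algebra S" by (rule ring_free_star_algebra)
  have "ideal (carrier (free_star_algebra S)) (free_star_algebra S)" by (rule oneideal)
  then have "carrier (free_star_algebra S)
      \<in> {I. ideal I (free_star_algebra S) \<and> Rel \<subseteq> I \<and> adj ` I \<subseteq> I}"
    using assms generators_in_carrier(2) by blast
  then have "{I. ideal I (free_star_algebra S) \<and> Rel \<subseteq> I \<and> adj ` I \<subseteq> I} \<noteq> {}"
    by blast
  then show ?thesis
    unfolding star_ideal_def by (rule i_Intersect[rotated]) simp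
qed

theorem (in self_similar_group) ring_nekrashevych_algebra:
  "ring (nekrashevych_algebra TYPE('k::field) G \<phi>)"
proof -
  let ?S = "nekrashevych_generators G :: ('x + 'g) set"
  let ?F = "free_star_algebra ?S :: ('x + 'g, 'k) nc_poly ring"
  interpret F: ring ?F by (rule ring_free_star_algebra)
  interpret G: group G using group_hom by (simp add: group_hom_def)
  note gens = generators_in_carrier(1)[where S = ?S]
  have l: "letter_gen x \<in> carrier ?F" for x
    by (rule gens) (simp add: nekrashevych_generators_def)
  have g: "g \<in> carrier G \<Longrightarrow> group_gen g \<in> carrier ?F" for g
    by (rule gens) (simp add: nekrashevych_generators_def)
  have sum: "(\<And>x. x \<in> A \<Longrightarrow> f x \<in> carrier ?F) \<Longrightarrow> (\<Sum>x \<in> A. f x) \<in> carrier ?F"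
    for f and A :: "'x set"
    by (induction A rule: infinite_finite_induct) (auto intro: free_star_algebra_closed free_star_algebra_closed2)
  have "nekrashevych_relations G \<phi> \<subseteq> carrier ?F"
    unfolding nekrashevych_relations_def
    by (auto intro!: free_star_algebra_closed free_star_algebra_closed2 sum l g section_at generators_in_carrier(2))
  then show ?thesis
    unfolding nekrashevych_algebra_def by (intro ideal.quotient_is_ring ideal_star_ideal)
qed

text \<open>Since the algebras are unital, ring ideals are closed under scalars: they are exactly the
  two-sided algebra ideals.\<close>

definition simple_algebra :: "('a, 'm) ring_scheme \<Rightarrow> bool" where
  "simple_algebra R \<longleftrightarrow>
     carrier R \<noteq> {\<zero>\<^bsub>R\<^esub>} \<and> (\<forall>I. ideal I R \<longrightarrow> I = {\<zero>\<^bsub>R\<^esub>} \<or> I = carrier R)"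

section \<open>The Basilica group\<close>

text \<open>The letters 0 and 1 are encoded as \<^const>\<open>False\<close> and \<^const>\<open>True\<close>.\<close>

fun basilica_a basilica_c :: "bool list \<Rightarrow> bool list" where
  "basilica_a [] = []"
| "basilica_a (False # w) = False # w"
| "basilica_a (True # w) = True # basilica_c w"
| "basilica_c [] = []"
| "basilica_c (False # w) = True # w"
| "basilica_c (True # w) = False # basilica_a w"

definition basilica :: "(bool list \<Rightarrow> bool list) monoid" where
  "basilica = subgroup_generated (BijGroup UNIV) {basilica_a, basilica_c}"

lemma length_basilica:
  "length (basilica_a w) = length w" "length (basilica_c w) = length w"
  by (induction w rule: basilica_a_basilica_c.induct) auto

lemma inj_basilica_aux:
  "(\<forall>v. basilica_a w = basilica_a v \<longrightarrow> w = v) \<and> (\<forall>v. basilica_c w = basilica_c v \<longrightarrow> w = v)"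
proof (induction w)
  case Nil
  show ?case using length_basilica by (metis length_0_conv basilica_a.simps(1) basilica_c.simps(1))
next
  case (Cons x w)
  show ?case
  proof (intro conjI allI impI)
    fix v assume *: "basilica_a (x # w) = basilica_a v"
    then obtain y u where "v = y # u"
      by (metis length_basilica(1) length_Suc_conv)
    with * Cons show "x # w = v" by (cases x; cases y) auto
  next
    fix v assume *: "basilica_c (x # w) = basilica_c v"
    then obtain y u where "v = y # u"
      by (metis length_basilica(2) length_Suc_conv)
    with * Cons show "x # w = v" by (cases x; cases y) auto
  qed
qed

lemma surj_basilica_aux: "(\<exists>v. basilica_a v = w) \<and> (\<exists>v. basilica_c v = w)"
proof (induction w)
  case Nil
  have "basilica_a [] = []" "basilica_c [] = []" by simp_all
  then show ?case by blast
next
  case (Cons x w)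
  then obtain u v where "basilica_a u = w" "basilica_c v = w" by blast
  then have "basilica_a ((if x then True # v else False # w)) = x # w"
    "basilica_c ((if x then False # w else True # u)) = x # w" by simp_all
  then show ?case by blast
qed

lemma bij_basilica: "bij basilica_a" "bij basilica_c"
proof -
  have "inj basilica_a" "inj basilica_c"
    using inj_basilica_aux by (blast intro: injI)+
  moreover have "surj basilica_a" "surj basilica_c"
    unfolding surj_def using surj_basilica_aux by (blast intro: sym)+
  ultimately show "bij basilica_a" "bij basilica_c" by (simp_all add: bij_def)
qed

lemma carrier_BijGroup_UNIV: "carrier (BijGroup UNIV) = {f. bij f}"
  by (auto simp: BijGroup_def Bij_def)

lemma carrier_basilica: "carrier basilica = generate (BijGroup UNIV) {basilica_a, basilica_c}"
  using bij_basilica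
  by (simp add: basilica_def carrier_subgroup_generated carrier_BijGroup_UNIV)

lemma basilica_gens_in: "basilica_a \<in> carrier basilica" "basilica_c \<in> carrier basilica"
  by (auto simp: carrier_basilica intro: generate.incl)

lemma group_basilica: "group basilica"
  unfolding basilica_def by (simp add: group.group_subgroup_generated group_BijGroup)

lemma bij_of_basilica: "f \<in> carrier basilica \<Longrightarrow> bij f"
  using group.carrier_subgroup_generated_subset[OF group_BijGroup]
  by (force simp: basilica_def carrier_BijGroup_UNIV)

lemma mult_BijGroup_UNIV: "bij f \<Longrightarrow> bij g \<Longrightarrow> f \<otimes>\<^bsub>BijGroup UNIV\<^esub> g = f \<circ> g"
  by (auto simp: BijGroup_def Bij_def compose_def)

lemma mult_basilica:
  "f \<in> carrier basilica \<Longrightarrow> g \<in> carrier basilica \<Longrightarrow> f \<otimes>\<^bsub>basilica\<^esub> g = f \<circ> g"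
  using mult_BijGroup_UNIV[of f g] bij_of_basilica by (simp add: basilica_def)

lemma one_basilica: "\<one>\<^bsub>basilica\<^esub> = id"
  by (auto simp: basilica_def BijGroup_def)

lemma inv_BijGroup_UNIV: "bij f \<Longrightarrow> inv\<^bsub>BijGroup UNIV\<^esub> f = Hilbert_Choice.inv f"
  by (subst inv_BijGroup) (auto simp: Bij_def)

lemma comp_in_basilica:
  "f \<in> carrier basilica \<Longrightarrow> g \<in> carrier basilica \<Longrightarrow> f \<circ> g \<in> carrier basilica"
  using mult_basilica[of f g] group_basilica by (metis group.is_monoid monoid.m_closed)

lemma inv_in_basilica: "f \<in> carrier basilica \<Longrightarrow> Hilbert_Choice.inv f \<in> carrier basilica"
proof -
  assume f: "f \<in> carrier basilica"
  interpret group basilica by (rule group_basilica)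
  define g where "g = inv\<^bsub>basilica\<^esub> f"
  have "f \<circ> g = id" "g \<circ> f = id" "g \<in> carrier basilica"
    using f r_inv[OF f] l_inv[OF f] mult_basilica one_basilica unfolding g_def by auto
  then show ?thesis by (metis inv_unique_comp)
qed

definition basilica_sections :: "(bool list \<Rightarrow> bool list) \<Rightarrow> bool" where
  "basilica_sections f \<longleftrightarrow> (\<forall>w. length (f w) = length w)
     \<and> (\<forall>x. \<exists>h \<in> carrier basilica. \<forall>w. f (x # w) = hd (f [x]) # h w)"

lemma basilica_sections_inv:
  assumes f: "bij f" "basilica_sections f"
  shows "basilica_sections (Hilbert_Choice.inv f)"
  unfolding basilica_sections_def
proof (intro conjI allI)
  fix w
  show len: "length (Hilbert_Choice.inv f w) = length w" for w
    using f unfolding basilica_sections_def by (metis bij_inv_eq_iff)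
  fix y
  obtain x where x: "Hilbert_Choice.inv f [y] = [x]"
    using len[of "[y]"] by (auto simp: length_Suc_conv)
  then have fx: "f [x] = [y]" using f by (metis bij_inv_eq_iff)
  obtain h where h: "h \<in> carrier basilica" "\<And>w. f (x # w) = y # h w"
    using f fx unfolding basilica_sections_def by (metis list.sel(1))
  have "Hilbert_Choice.inv f (y # w) = x # Hilbert_Choice.inv h w" for w
    using h f bij_of_basilica[OF h(1)] by (metis bij_inv_eq_iff)
  then show "\<exists>h \<in> carrier basilica. \<forall>w. Hilbert_Choice.inv f (y # w)
      = hd (Hilbert_Choice.inv f [y]) # h w"
    using inv_in_basilica[OF h(1)] x by auto
qed

lemma basilica_sections_comp:
  assumes f: "basilica_sections f" and g: "basilica_sections g"
  shows "basilica_sections (f \<circ> g)"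
  unfolding basilica_sections_def
proof (intro conjI allI)
  show "length ((f \<circ> g) w) = length w" for w
    using f g by (simp add: basilica_sections_def)
  fix x
  obtain h where h: "h \<in> carrier basilica" "\<And>w. g (x # w) = hd (g [x]) # h w"
    using g unfolding basilica_sections_def by blast
  obtain k where k: "k \<in> carrier basilica"
      "\<And>w. f (hd (g [x]) # w) = hd (f [hd (g [x])]) # k w"
    using f unfolding basilica_sections_def by blast
  have "(f \<circ> g) (x # w) = hd ((f \<circ> g) [x]) # (k \<circ> h) w" for w
    using h(2) k(2) by (metis comp_apply list.sel(1))
  then show "\<exists>h \<in> carrier basilica. \<forall>w. (f \<circ> g) (x # w) = hd ((f \<circ> g) [x]) # h w"
    using comp_in_basilica[OF k(1) h(1)] by blast
qed

lemma id_in_basilica: "id \<in> carrier basilica"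
  using group_basilica one_basilica by (metis group.is_monoid monoid.one_closed)

lemma basilica_sections_id: "basilica_sections id"
  using id_in_basilica by (auto simp: basilica_sections_def intro!: bexI[of _ id])

lemma basilica_sections_gens: "basilica_sections basilica_a" "basilica_sections basilica_c"
  unfolding basilica_sections_def
proof (safe, goal_cases)
  case (2 x)
  show ?case using id_in_basilica basilica_gens_in
    by (cases x) (auto intro: bexI[of _ id] bexI[of _ basilica_c])
next
  case (4 x)
  show ?case using id_in_basilica basilica_gens_in
    by (cases x) (auto intro: bexI[of _ id] bexI[of _ basilica_a])
qed (rule length_basilica)+

lemma basilica_sections: "f \<in> carrier basilica \<Longrightarrow> basilica_sections f"
  unfolding carrier_basilica
proof (induction rule: generate.induct)
  case one
  then show ?case using basilica_sections_id by (simp add: BijGroup_def id_def)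
next
  case (incl h)
  then show ?case using basilica_sections_gens by blast
next
  case (inv h)
  then show ?case
    using basilica_sections_gens basilica_sections_inv bij_basilica inv_BijGroup_UNIV by fastforce
next
  case (eng h1 h2)
  then have "h1 \<otimes>\<^bsub>BijGroup UNIV\<^esub> h2 = h1 \<circ> h2"
    by (intro mult_BijGroup_UNIV bij_of_basilica) (simp_all add: carrier_basilica)
  then show ?case
    using basilica_sections_comp eng.IH by metis
qed

theorem self_similar_basilica: "self_similar_group basilica (\<lambda>g. g)"
proof -
  have "(\<lambda>g. g) \<in> hom basilica (BijGroup UNIV)"
    using bij_of_basilica by (auto simp: hom_def basilica_def carrier_BijGroup_UNIV)
  then have "group_action basilica UNIV (\<lambda>g. g)"
    by (simp add: group_action_def group_hom_def group_hom_axioms_def group_basilica group_BijGroup)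
  then show ?thesis
    using basilica_sections
    by (auto simp: self_similar_group_def self_similar_group_axioms_def faithful_action_def
        faithful_action_axioms_def basilica_sections_def)
qed

end

theory Submission
  imports Defs
begin

text \<open>
  The nucleus of the Basilica group consists of the seven elements
  \<open>1\<close>, \<open>a\<close>, \<open>a\<^sup>-\<^sup>1\<close>, \<open>c\<close>, \<open>c\<^sup>-\<^sup>1\<close>, \<open>a c\<^sup>-\<^sup>1\<close>, \<open>c a\<^sup>-\<^sup>1\<close>: every group element has all its
  sections at sufficiently long words among them.  Simplicity is obtained in the strongest form:
  for each nonzero \<open>p\<close> of the algebra there are \<open>b\<close> and \<open>c\<close> with \<open>b p c = 1\<close>.

  Multiplying on the right by a long word \<open>v\<close> turns \<open>p\<close> into a combination of monomials
  \<open>u g\<close> with \<open>u\<close> a word and \<open>g\<close> in the nucleus, because \<open>v\<close> absorbs all adjoints of letters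
  and then all group elements are replaced by sections.  Since \<open>\<Sum> x x\<^sup>* = 1\<close>, the word can be
  chosen so that the product is not zero; by the same relation, stripping first letters with
  \<open>y\<^sup>*\<close> leads to \<open>e + r\<close>, where \<open>e \<noteq> 0\<close> lies in the span of the nucleus and all monomials of \<open>r\<close>
  have nonempty words.  Two facts finish the proof.

  \<^item> Passing to a corner \<open>y\<^sup>* (e + r) x\<close> acts on \<open>e\<close> and \<open>r\<close> separately, and keeps the words of
    \<open>r\<close> nonempty.  A nonzero \<open>e\<close> becomes a nonzero scalar after a few corners: this is
    a computation with the seven coefficients (\<open>compresses_nucleus_sum\<close>).
  \<^item> Once \<open>e\<close> is a scalar, the corner \<open>y\<^sup>* (e + r) y\<close> with \<open>y\<close> different from the first letter
    of a monomial of \<open>r\<close> removes this monomial and fixes \<open>e\<close> (\<open>scalar_plus_tail\<close>).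

  The resulting criterion \<open>simple_nekrashevych_algebra\<close> holds for every contracting self-similar
  group whose nucleus spans a space in which nonzero elements compress to scalars.  It also needs
  that the algebra is not zero, which is seen from its action on functions on words, taken modulo
  those that vanish on all long words.
\<close>

section \<open>Calculating modulo the defining relations\<close>

lemma minus_free_star_algebra:
  assumes "p \<in> carrier (free_star_algebra S)"
  shows "\<ominus>\<^bsub>free_star_algebra S\<^esub> p = - p"
proof -
  interpret ring "free_star_algebra S" by (rule ring_free_star_algebra)
  show ?thesis
    using minus_equality[of "- p" p] assms by (simp add: free_star_algebra_closed)
qed

lemma adj_one: "adj 1 = 1"
proof -
  have "word_adj 0 = (0 :: 'a gen free_monoid)"
    by (simp add: word_adj_def zero_free_monoid_def)
  then show ?thesis
    by (metis adj_single single_one)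
qed

lemma adj_diff: "adj (p - q) = adj p - adj q"
  by (rule poly_mapping_eqI) (simp add: lookup_adj lookup_minus)

context self_similar_group
begin

sublocale G: group G
  using group_hom by (simp add: group_hom_def)

definition nek_carrier :: "('x + 'g, 'k::field) nc_poly set" where
  "nek_carrier = carrier (free_star_algebra (nekrashevych_generators G))"

definition nek_ideal :: "('x + 'g, 'k::field) nc_poly set" where
  "nek_ideal = star_ideal (nekrashevych_generators G) (nekrashevych_relations G \<phi>)"

text \<open>Membership in the carrier is part of the relation, so that it is compatible with
  multiplication.\<close>

definition nek_cong :: "('x + 'g, 'k::field) nc_poly \<Rightarrow> ('x + 'g, 'k) nc_poly \<Rightarrow> bool"
    (infix \<open>\<doteq>\<close> 50) where
  "p \<doteq> q \<longleftrightarrow> p \<in> nek_carrier \<and> q \<in> nek_carrier \<and> p - q \<in> nek_ideal"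

lemma nek_carrier_closed [simp, intro]:
  "1 \<in> nek_carrier" "0 \<in> nek_carrier"
  "p \<in> nek_carrier \<Longrightarrow> - p \<in> nek_carrier"
  "p \<in> nek_carrier \<Longrightarrow> q \<in> nek_carrier \<Longrightarrow> p + q \<in> nek_carrier"
  "p \<in> nek_carrier \<Longrightarrow> q \<in> nek_carrier \<Longrightarrow> p - q \<in> nek_carrier"
  "p \<in> nek_carrier \<Longrightarrow> q \<in> nek_carrier \<Longrightarrow> p * q \<in> nek_carrier"
  "p \<in> nek_carrier \<Longrightarrow> adj p \<in> nek_carrier"
  by (simp_all add: nek_carrier_def free_star_algebra_closed free_star_algebra_closed2
      generators_in_carrier)

lemma nek_carrier_sum: "(\<And>i. i \<in> A \<Longrightarrow> f i \<in> nek_carrier) \<Longrightarrow> sum f A \<in> nek_carrier"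
  by (induction A rule: infinite_finite_induct) auto

lemma letter_in_carrier [simp, intro]: "letter_gen x \<in> nek_carrier"
  by (simp add: nek_carrier_def nekrashevych_generators_def generators_in_carrier)

lemma group_in_carrier [simp, intro]: "g \<in> carrier G \<Longrightarrow> group_gen g \<in> nek_carrier"
  by (simp add: nek_carrier_def nekrashevych_generators_def generators_in_carrier)

lemma const_in_carrier [simp, intro]: "Poly_Mapping.single 0 k \<in> nek_carrier"
  by (simp add: nek_carrier_def in_free_star_algebra_iff zero_free_monoid_def)

lemma relations_in_carrier: "nekrashevych_relations G \<phi> \<subseteq> nek_carrier"
  unfolding nekrashevych_relations_def
  by (auto intro!: nek_carrier_closed nek_carrier_sum section_at)

lemma relations_in_ideal: "nekrashevych_relations G \<phi> \<subseteq> nek_ideal"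
  by (auto simp: nek_ideal_def star_ideal_def)

lemma ideal_nek: "ideal nek_ideal (free_star_algebra (nekrashevych_generators G))"
  unfolding nek_ideal_def
  by (rule ideal_star_ideal) (use relations_in_carrier in \<open>simp add: nek_carrier_def\<close>)

lemma nek_ideal_in_carrier: "p \<in> nek_ideal \<Longrightarrow> p \<in> nek_carrier"
  using ideal.Icarr[OF ideal_nek] by (simp add: nek_carrier_def)

lemma nek_ideal_closed:
  shows "0 \<in> nek_ideal"
    and "p \<in> nek_ideal \<Longrightarrow> q \<in> nek_ideal \<Longrightarrow> p + q \<in> nek_ideal"
    and "p \<in> nek_ideal \<Longrightarrow> - p \<in> nek_ideal"
    and "p \<in> nek_ideal \<Longrightarrow> r \<in> nek_carrier \<Longrightarrow> r * p \<in> nek_ideal"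
    and "p \<in> nek_ideal \<Longrightarrow> r \<in> nek_carrier \<Longrightarrow> p * r \<in> nek_ideal"
proof -
  interpret ideal nek_ideal "free_star_algebra (nekrashevych_generators G)" by (rule ideal_nek)
  show "0 \<in> nek_ideal"
    using additive_subgroup.zero_closed[OF is_additive_subgroup] by simp
  show "p \<in> nek_ideal \<Longrightarrow> q \<in> nek_ideal \<Longrightarrow> p + q \<in> nek_ideal"
    using additive_subgroup.a_closed[OF is_additive_subgroup, of p q] by simp
  show "p \<in> nek_ideal \<Longrightarrow> - p \<in> nek_ideal"
    using additive_subgroup.a_inv_closed[OF is_additive_subgroup, of p] minus_free_star_algebra[of p] Icarr[of p] by simp
  show "p \<in> nek_ideal \<Longrightarrow> r \<in> nek_carrier \<Longrightarrow> r * p \<in> nek_ideal"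
    using I_l_closed[of p r] by (simp add: nek_carrier_def)
  show "p \<in> nek_ideal \<Longrightarrow> r \<in> nek_carrier \<Longrightarrow> p * r \<in> nek_ideal"
    using I_r_closed[of p r] by (simp add: nek_carrier_def)
qed

lemma nek_cong_carrier: "p \<doteq> q \<Longrightarrow> p \<in> nek_carrier" "p \<doteq> q \<Longrightarrow> q \<in> nek_carrier"
  by (simp_all add: nek_cong_def)

lemma nek_cong_refl [intro]: "p \<in> nek_carrier \<Longrightarrow> p \<doteq> p"
  by (simp add: nek_cong_def nek_ideal_closed)

lemma nek_cong_sym: "p \<doteq> q \<Longrightarrow> q \<doteq> p"
  using nek_ideal_closed(3)[of "p - q"] by (simp add: nek_cong_def)

lemma nek_cong_trans [trans]: "p \<doteq> q \<Longrightarrow> q \<doteq> r \<Longrightarrow> p \<doteq> r"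
  using nek_ideal_closed(2)[of "p - q" "q - r"] by (simp add: nek_cong_def)

lemma nek_cong_add: "p \<doteq> q \<Longrightarrow> r \<doteq> s \<Longrightarrow> p + r \<doteq> q + s"
  using nek_ideal_closed(2)[of "p - q" "r - s"] by (auto simp: nek_cong_def algebra_simps)

lemma nek_cong_mult:
  assumes "p \<doteq> q" "r \<doteq> s"
  shows "p * r \<doteq> q * s"
proof -
  have "(p - q) * r + q * (r - s) \<in> nek_ideal"
    using assms unfolding nek_cong_def by (blast intro: nek_ideal_closed)
  also have "(p - q) * r + q * (r - s) = p * r - q * s"
    by (simp add: algebra_simps)
  finally show ?thesis using assms by (auto simp: nek_cong_def)
qed

lemma nek_cong_lmult: "r \<in> nek_carrier \<Longrightarrow> p \<doteq> q \<Longrightarrow> r * p \<doteq> r * q"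
  by (simp add: nek_cong_mult nek_cong_refl)

lemma nek_cong_rmult: "r \<in> nek_carrier \<Longrightarrow> p \<doteq> q \<Longrightarrow> p * r \<doteq> q * r"
  by (simp add: nek_cong_mult nek_cong_refl)

lemma nek_cong_sum: "(\<And>i. i \<in> A \<Longrightarrow> f i \<doteq> h i) \<Longrightarrow> sum f A \<doteq> sum h A"
  by (induction A rule: infinite_finite_induct) (auto intro: nek_cong_add)

lemma nek_cong_zero_iff: "p \<doteq> 0 \<longleftrightarrow> p \<in> nek_ideal"
  using nek_ideal_in_carrier by (auto simp: nek_cong_def)

lemma nek_cong_ideal_iff: "p \<doteq> q \<Longrightarrow> p \<in> nek_ideal \<longleftrightarrow> q \<in> nek_ideal"
  using nek_cong_zero_iff nek_cong_trans nek_cong_sym by blast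

lemma nek_relations:
  fixes x y :: 'x
  shows "group_gen \<one> \<doteq> 1"
    and "g \<in> carrier G \<Longrightarrow> adj (group_gen g) \<doteq> group_gen (inv g)"
    and "g \<in> carrier G \<Longrightarrow> h \<in> carrier G \<Longrightarrow> group_gen g * group_gen h \<doteq> group_gen (g \<otimes> h)"
    and "g \<in> carrier G \<Longrightarrow> group_gen g * letter_gen x
      \<doteq> letter_gen (act_letter \<phi> g x) * group_gen (section_at G \<phi> g x)"
    and "adj (letter_gen y) * letter_gen x \<doteq> (if x = y then 1 else 0)"
    and "(\<Sum>x \<in> UNIV. letter_gen x * adj (letter_gen x)) \<doteq> 1"
proof -
  have rel: "p \<doteq> q"
    if "p - q \<in> nekrashevych_relations G \<phi>" "p \<in> nek_carrier" "q \<in> nek_carrier"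
    for p q :: "('x + 'g, 'k::field) nc_poly"
    using that relations_in_ideal by (auto simp: nek_cong_def)
  show "group_gen \<one> \<doteq> 1"
    by (rule rel) (auto simp: nekrashevych_relations_def)
  show "adj (group_gen g) \<doteq> group_gen (inv g)" if "g \<in> carrier G"
    by (rule rel) (use that in \<open>auto simp: nekrashevych_relations_def\<close>)
  show "group_gen g * group_gen h \<doteq> group_gen (g \<otimes> h)" if "g \<in> carrier G" "h \<in> carrier G"
    by (rule rel) (use that in \<open>auto simp: nekrashevych_relations_def\<close>)
  show "group_gen g * letter_gen x
      \<doteq> letter_gen (act_letter \<phi> g x) * group_gen (section_at G \<phi> g x)" if "g \<in> carrier G"
    by (rule rel) (use that section_at in \<open>auto simp: nekrashevych_relations_def\<close>)
  show "adj (letter_gen y) * letter_gen x \<doteq> (if x = y then 1 else 0)"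
    by (rule rel, unfold nekrashevych_relations_def, blast) auto
  show "(\<Sum>x \<in> UNIV. letter_gen x * adj (letter_gen x)) \<doteq> 1"
    by (rule rel, unfold nekrashevych_relations_def, blast) (auto intro!: nek_carrier_sum)
qed

text \<open>Because of \<open>1 = \<Sum> x x\<^sup>*\<close>, a nonzero element stays nonzero after multiplication with a
  suitable letter on the right, or with the adjoint of a suitable letter on the left.\<close>

lemma ex_letter_right:
  assumes "p \<in> nek_carrier" "p \<notin> nek_ideal"
  shows "\<exists>x. p * letter_gen x \<notin> nek_ideal"
proof (rule ccontr)
  assume "\<nexists>x. p * letter_gen x \<notin> nek_ideal"
  then have "p * letter_gen x * adj (letter_gen x) \<doteq> 0" for x
    using nek_ideal_closed(5) nek_cong_zero_iff by blast
  then have "(\<Sum>x \<in> UNIV. p * letter_gen x * adj (letter_gen x)) \<doteq> (\<Sum>x \<in> (UNIV :: 'x set). 0)"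
    by (intro nek_cong_sum)
  moreover have "p * (\<Sum>x \<in> UNIV. letter_gen x * adj (letter_gen x)) \<doteq> p * 1"
    using assms nek_relations by (intro nek_cong_lmult)
  ultimately have "p \<doteq> 0"
    by (simp add: sum_distrib_left mult.assoc) (blast intro: nek_cong_trans nek_cong_sym)
  then show False using assms nek_cong_zero_iff by blast
qed

lemma ex_letter_left:
  assumes "p \<in> nek_carrier" "p \<notin> nek_ideal"
  shows "\<exists>x. adj (letter_gen x) * p \<notin> nek_ideal"
proof (rule ccontr)
  assume "\<nexists>x. adj (letter_gen x) * p \<notin> nek_ideal"
  then have "letter_gen x * (adj (letter_gen x) * p) \<doteq> 0" for x
    using nek_ideal_closed(4) nek_cong_zero_iff by blast
  then have "(\<Sum>x \<in> UNIV. letter_gen x * (adj (letter_gen x) * p)) \<doteq> (\<Sum>x \<in> (UNIV :: 'x set). 0)"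
    by (intro nek_cong_sum)
  moreover have "(\<Sum>x \<in> UNIV. letter_gen x * adj (letter_gen x)) * p \<doteq> 1 * p"
    using assms nek_relations by (intro nek_cong_rmult)
  ultimately have "p \<doteq> 0"
    by (simp add: sum_distrib_right mult.assoc) (blast intro: nek_cong_trans nek_cong_sym)
  then show False using assms nek_cong_zero_iff by blast
qed

end

section \<open>The algebra is not zero\<close>

lemma nc_poly_eq_sum_single:
  fixes p :: "('a, 'k::field) nc_poly"
  shows "p = (\<Sum>u \<in> Poly_Mapping.keys p. Poly_Mapping.single u (Poly_Mapping.lookup p u))"
  by (rule poly_mapping_eqI) (auto simp: lookup_sum lookup_single when_def in_keys_iff)

lemma adj_zero: "adj 0 = 0"
  by (simp add: adj_def)

lemma gen_Sum_cases:
  obtains (letter) x where "s = Gen (Inl x)" | (letter_adj) x where "s = Adj (Inl x)"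
    | (group) g where "s = Gen (Inr g)" | (group_adj) g where "s = Adj (Inr g)"
  by (metis gen.exhaust sum.exhaust)

context self_similar_group
begin

text \<open>Letters and group elements act on the functions on words as on functions on infinite words: \<open>x\<close>
  moves \<open>f\<close> to the words that begin with \<open>x\<close>, and \<open>g\<close> is composition with \<open>g\<^sup>-\<^sup>1\<close>.  The only relation
  that fails is \<open>\<Sum> x x\<^sup>* = 1\<close>, and only at the empty word.  Since
  every generator changes the length of a word by at most one, the functions that vanish on all long
  words are mapped to such functions, and modulo these all relations hold.\<close>

fun gen_op :: "('x + 'g) gen \<Rightarrow> ('x list \<Rightarrow> 'k::field) \<Rightarrow> 'x list \<Rightarrow> 'k" where
  "gen_op (Gen (Inl x)) f w = (case w of [] \<Rightarrow> 0 | y # v \<Rightarrow> if y = x then f v else 0)"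
| "gen_op (Adj (Inl x)) f w = f (x # w)"
| "gen_op (Gen (Inr g)) f w = f (\<phi> (inv g) w)"
| "gen_op (Adj (Inr g)) f w = f (\<phi> g w)"

definition word_op ::
    "('x + 'g) gen free_monoid \<Rightarrow> ('x list \<Rightarrow> 'k::field) \<Rightarrow> 'x list \<Rightarrow> 'k" where
  "word_op u = foldr gen_op (letters u)"

definition poly_op ::
    "('x + 'g, 'k::field) nc_poly \<Rightarrow> ('x list \<Rightarrow> 'k) \<Rightarrow> 'x list \<Rightarrow> 'k" where
  "poly_op p f w = (\<Sum>u \<in> Poly_Mapping.keys p. Poly_Mapping.lookup p u * word_op u f w)"

lemma poly_op_superset:
  "finite A \<Longrightarrow> Poly_Mapping.keys p \<subseteq> A
    \<Longrightarrow> poly_op p f w = (\<Sum>u \<in> A. Poly_Mapping.lookup p u * word_op u f w)"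
  unfolding poly_op_def by (rule sum.mono_neutral_left) (auto simp: in_keys_iff)

lemma poly_op_zero: "poly_op 0 f w = 0"
  by (simp add: poly_op_def)

lemma poly_op_add: "poly_op (p + q) f w = poly_op p f w + poly_op q f w"
proof -
  let ?A = "Poly_Mapping.keys p \<union> Poly_Mapping.keys q"
  have "Poly_Mapping.keys (p + q) \<subseteq> ?A" by (rule Poly_Mapping.keys_add)
  then show ?thesis
    by (simp add: poly_op_superset[of ?A] lookup_add distrib_right sum.distrib)
qed

lemma poly_op_uminus: "poly_op (- p) f w = - poly_op p f w"
  by (simp add: poly_op_def sum_negf)

lemma poly_op_diff: "poly_op (p - q) f w = poly_op p f w - poly_op q f w"
  using poly_op_add[of p "- q"] by (simp add: poly_op_uminus)

lemma poly_op_sum: "poly_op (sum h A) f w = (\<Sum>i \<in> A. poly_op (h i) f w)"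
  by (induction A rule: infinite_finite_induct) (simp_all add: poly_op_add poly_op_zero)

lemma poly_op_single: "poly_op (Poly_Mapping.single u c) f w = c * word_op u f w"
  by (simp add: poly_op_superset[of "{u}"])

lemma gen_op_linear:
  "gen_op s (\<lambda>w. \<Sum>i \<in> A. c i * f i w) = (\<lambda>w. \<Sum>i \<in> A. c i * gen_op s (f i) w)"
  by (rule ext, cases s rule: gen_Sum_cases) (auto split: list.split)

lemma word_op_linear:
  "word_op u (\<lambda>w. \<Sum>i \<in> A. c i * f i w) = (\<lambda>w. \<Sum>i \<in> A. c i * word_op u (f i) w)"
proof -
  have "foldr gen_op s (\<lambda>w. \<Sum>i \<in> A. c i * f i w)
      = (\<lambda>w. \<Sum>i \<in> A. c i * foldr gen_op s (f i) w)" for s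
    by (induction s) (simp_all add: gen_op_linear)
  then show ?thesis by (simp add: word_op_def)
qed

lemma poly_op_mult: "poly_op (p * q) f = poly_op p (poly_op q f)"
proof
  fix w
  have "p * q = (\<Sum>u \<in> Poly_Mapping.keys p. \<Sum>v \<in> Poly_Mapping.keys q.
      Poly_Mapping.single (u + v) (Poly_Mapping.lookup p u * Poly_Mapping.lookup q v))"
    by (subst nc_poly_eq_sum_single[of p], subst nc_poly_eq_sum_single[of q])
       (simp add: sum_product mult_single)
  then have "poly_op (p * q) f w = (\<Sum>u \<in> Poly_Mapping.keys p. \<Sum>v \<in> Poly_Mapping.keys q.
      Poly_Mapping.lookup p u * (Poly_Mapping.lookup q v * word_op u (word_op v f) w))"
    by (simp add: poly_op_sum poly_op_single word_op_def plus_free_monoid_def mult.assoc)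
  also have "\<dots> = poly_op p (poly_op q f) w"
    by (simp add: poly_op_def[of p] poly_op_def[of q, abs_def] word_op_linear sum_distrib_left)
  finally show "poly_op (p * q) f w = poly_op p (poly_op q f) w" .
qed

definition negligible :: "('x list \<Rightarrow> 'k::field) \<Rightarrow> bool" where
  "negligible f \<longleftrightarrow> (\<exists>n. \<forall>w. n \<le> length w \<longrightarrow> f w = 0)"

lemma negligible_zero: "negligible (\<lambda>w. 0)"
  by (simp add: negligible_def)

lemma negligible_add: "negligible f \<Longrightarrow> negligible h \<Longrightarrow> negligible (\<lambda>w. f w + h w)"
  unfolding negligible_def by (metis add_0 le_trans nle_le)

lemma negligible_scale: "negligible f \<Longrightarrow> negligible (\<lambda>w. c * f w)"
  by (auto simp: negligible_def)

lemma negligible_gen_op: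
  assumes "gen_base s \<in> nekrashevych_generators G" and "negligible f"
  shows "negligible (gen_op s f)"
proof -
  obtain n where n: "\<And>w. n \<le> length w \<Longrightarrow> f w = 0"
    using assms(2) by (auto simp: negligible_def)
  have "gen_op s f w = 0" if "Suc n \<le> length w" for w
    using that assms(1) n length_preserving
    by (cases s rule: gen_Sum_cases) (auto simp: nekrashevych_generators_def split: list.split)
  then show ?thesis by (auto simp: negligible_def)
qed

lemma negligible_poly_op:
  assumes "p \<in> nek_carrier" and "negligible f"
  shows "negligible (poly_op p f)"
proof -
  have "negligible (foldr gen_op s f)" if "gen_base ` set s \<subseteq> nekrashevych_generators G" for s
    using that by (induction s) (auto intro: assms negligible_gen_op)
  then have "negligible (word_op u f)" if "u \<in> Poly_Mapping.keys p" for u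
    using that assms by (auto simp: word_op_def nek_carrier_def free_star_algebra_def)
  moreover have "negligible (\<lambda>w. \<Sum>u \<in> A. Poly_Mapping.lookup p u * word_op u f w)"
    if "\<And>u. u \<in> A \<Longrightarrow> negligible (word_op u f)" for A
    using that by (induction A rule: infinite_finite_induct)
      (simp_all add: negligible_zero negligible_add negligible_scale)
  ultimately show ?thesis by (simp add: poly_op_def[abs_def])
qed

text \<open>The condition on the adjoint makes the set closed under the involution without an inner product
  on the functions.\<close>

definition annihilator :: "('x + 'g, 'k::field) nc_poly set" where
  "annihilator = {p \<in> nek_carrier.
     \<forall>f. negligible (poly_op p f) \<and> negligible (poly_op (adj p) f)}"

lemma ideal_annihilator:
  "ideal (annihilator :: ('x + 'g, 'k::field) nc_poly set)
    (free_star_algebra (nekrashevych_generators G))"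
proof (rule idealI)
  let ?F = "free_star_algebra (nekrashevych_generators G) :: ('x + 'g, 'k) nc_poly ring"
  show "ring ?F" by (rule ring_free_star_algebra)
  then interpret F: ring ?F .
  show "subgroup annihilator (add_monoid ?F)"
  proof (rule F.add.subgroupI)
    show "annihilator \<subseteq> carrier ?F"
      by (auto simp: annihilator_def nek_carrier_def)
    have "0 \<in> annihilator"
      by (auto simp: annihilator_def adj_zero poly_op_zero negligible_def)
    then show "annihilator \<noteq> {}" by blast
  next
    fix p :: "('x + 'g, 'k) nc_poly" assume "p \<in> annihilator"
    moreover have "adj (- p) = - adj p" by (rule poly_mapping_eqI) (simp add: lookup_adj)
    moreover have "\<ominus>\<^bsub>?F\<^esub> p = - p"
      using \<open>p \<in> annihilator\<close> minus_free_star_algebra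
      by (auto simp: annihilator_def nek_carrier_def)
    ultimately show "\<ominus>\<^bsub>?F\<^esub> p \<in> annihilator"
      by (auto simp: annihilator_def poly_op_uminus negligible_def)
  next
    fix p q :: "('x + 'g, 'k) nc_poly" assume "p \<in> annihilator" "q \<in> annihilator"
    then show "p \<oplus>\<^bsub>?F\<^esub> q \<in> annihilator"
      by (auto simp: annihilator_def adj_add poly_op_add[abs_def] intro: negligible_add)
  qed
  fix p q :: "('x + 'g, 'k) nc_poly"
  assume p: "p \<in> annihilator" and q: "q \<in> carrier ?F"
  then have "q \<in> nek_carrier" by (simp add: nek_carrier_def)
  with p show "q \<otimes>\<^bsub>?F\<^esub> p \<in> annihilator"
    "p \<otimes>\<^bsub>?F\<^esub> q \<in> annihilator"
    by (auto simp: annihilator_def adj_mult poly_op_mult intro: negligible_poly_op)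
qed

lemma act_one: "\<phi> \<one> w = w"
  using id_eq_one by (metis UNIV_I restrict_apply)

lemma act_mult: "g \<in> carrier G \<Longrightarrow> h \<in> carrier G \<Longrightarrow> \<phi> (g \<otimes> h) w = \<phi> g (\<phi> h w)"
  by (rule composition_rule) auto

lemma act_inv [simp]:
  "g \<in> carrier G \<Longrightarrow> \<phi> (inv g) (\<phi> g w) = w"
  "g \<in> carrier G \<Longrightarrow> \<phi> g (\<phi> (inv g) w) = w"
  by (metis act_mult act_one G.inv_closed G.l_inv)
     (metis act_mult act_one G.inv_closed G.r_inv)

lemma relations_annihilate: "nekrashevych_relations G \<phi> \<subseteq> annihilator"
proof
  fix r :: "('x + 'g, 'k::field) nc_poly"
  assume r: "r \<in> nekrashevych_relations G \<phi>"
  note op_simps = gen_def adj_diff adj_mult adj_single adj_one adj_sum word_adj_def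
    poly_op_diff poly_op_mult poly_op_single poly_op_sum word_op_def
  have one: "poly_op 1 f = f" for f :: "'x list \<Rightarrow> 'k"
    by (rule ext) (metis poly_op_single single_one mult_1 word_op_def zero_free_monoid_def
        free_monoid.sel foldr.simps(1) id_apply)
  have sect: "\<phi> g (x # w) = act_letter \<phi> g x # \<phi> (section_at G \<phi> g x) w"
      "section_at G \<phi> g x \<in> carrier G" if "g \<in> carrier G" for g x w
    using section_at[OF that] by blast+
  have sect_inv: "\<phi> (inv g) (act_letter \<phi> g x # w) = x # \<phi> (inv (section_at G \<phi> g x)) w"
    if "g \<in> carrier G" for g x w
    using sect[OF that] act_inv that by metis
  have sect_inv_neq: "hd (\<phi> (inv g) (y # w)) \<noteq> x"
    if "g \<in> carrier G" "y \<noteq> act_letter \<phi> g x" for g x y w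
  proof
    assume "hd (\<phi> (inv g) (y # w)) = x"
    moreover have "length (\<phi> (inv g) (y # w)) = Suc (length w)"
      using length_preserving that by simp
    ultimately have "\<phi> (inv g) (y # w) = x # tl (\<phi> (inv g) (y # w))"
      by (metis length_0_conv list.collapse nat.distinct(1))
    then have "y # w = \<phi> g (x # tl (\<phi> (inv g) (y # w)))"
      using act_inv(2)[OF that(1)] by metis
    then show False using sect(1)[OF that(1)] that(2) by simp
  qed
  have "poly_op r f w = 0 \<and> poly_op (adj r) f w = 0" if "w \<noteq> []" for f w
    using r unfolding nekrashevych_relations_def
  proof (elim UnE)
    assume "r \<in> {group_gen \<one> - 1}"
    then show ?thesis by (simp add: op_simps one act_one)
  next
    assume "r \<in> {adj (group_gen g) - group_gen (inv g) |g. g \<in> carrier G}"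
    then show ?thesis by (auto simp: op_simps)
  next
    assume "r \<in> {group_gen g * group_gen h - group_gen (g \<otimes> h) |g h. g \<in> carrier G \<and> h \<in> carrier G}"
    then show ?thesis by (auto simp: op_simps act_mult G.inv_mult_group)
  next
    assume "r \<in> {group_gen g * letter_gen x
      - letter_gen (act_letter \<phi> g x) * group_gen (section_at G \<phi> g x) |g x. g \<in> carrier G}"
    then obtain g x where g: "g \<in> carrier G" and r: "r = group_gen g * letter_gen x
      - letter_gen (act_letter \<phi> g x) * group_gen (section_at G \<phi> g x)" by blast
    obtain y v where w: "w = y # v" using \<open>w \<noteq> []\<close> by (cases w) auto
    have "\<phi> (inv g) w \<noteq> []"
      using length_preserving[of "inv g" w] g w by (metis G.inv_closed length_0_conv list.distinct(1))
    have "poly_op r f w = 0"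
    proof (cases "y = act_letter \<phi> g x")
      case True
      then show ?thesis using sect_inv[OF g, of x v] by (simp add: r w op_simps)
    next
      case False
      obtain z u where "\<phi> (inv g) w = z # u"
        using \<open>\<phi> (inv g) w \<noteq> []\<close> by (cases "\<phi> (inv g) w") auto
      then show ?thesis using False sect_inv_neq[OF g False, of v] by (simp add: r w op_simps)
    qed
    moreover have "poly_op (adj r) f w = 0"
      using g by (simp add: r op_simps sect)
    ultimately show ?thesis ..
  next
    assume "r \<in> {adj (letter_gen y) * letter_gen x - (if x = y then 1 else 0) |x y. True}"
    then show ?thesis
      by (auto simp: op_simps one poly_op_zero adj_zero)
  next
    assume "r \<in> {(\<Sum>x \<in> UNIV. letter_gen x * adj (letter_gen x)) - 1}"
    then show ?thesis
      using that by (cases w) (auto simp: op_simps one)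
  qed
  then show "r \<in> annihilator"
    using r relations_in_carrier
    by (auto simp: annihilator_def negligible_def Suc_le_eq intro!: exI[of _ "Suc 0"])
qed

theorem one_notin_nek_ideal: "1 \<notin> nek_ideal"
proof
  assume "(1 :: ('x + 'g, 'k::field) nc_poly) \<in> nek_ideal"
  moreover have "adj ` annihilator \<subseteq> (annihilator :: ('x + 'g, 'k::field) nc_poly set)"
    by (auto simp: annihilator_def adj_invol)
  then have "nek_ideal \<subseteq> (annihilator :: ('x + 'g, 'k::field) nc_poly set)"
    using ideal_annihilator relations_annihilate
    unfolding nek_ideal_def star_ideal_def by blast
  ultimately have "negligible (poly_op (1 :: ('x + 'g, 'k::field) nc_poly) (\<lambda>w. 1))"
    by (auto simp: annihilator_def)
  moreover have "poly_op (1 :: ('x + 'g, 'k::field) nc_poly) (\<lambda>w. 1) w = 1" for w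
    by (metis poly_op_single single_one mult_1 word_op_def zero_free_monoid_def
        free_monoid.sel foldr.simps(1) id_apply)
  ultimately obtain n where "\<And>w :: 'x list. length w < n"
    by (force simp: negligible_def not_le[symmetric])
  then show False
    using Ex_list_of_length by (metis less_irrefl)
qed

end

section \<open>A criterion for simplicity\<close>

context self_similar_group
begin

definition monomial :: "'k::field \<Rightarrow> 'x list \<Rightarrow> 'g \<Rightarrow> ('x + 'g, 'k) nc_poly" where
  "monomial k u g = Poly_Mapping.single (Word (map (Gen \<circ> Inl) u @ [Gen (Inr g)])) k"

definition letter_word :: "'x list \<Rightarrow> ('x + 'g, 'k::field) nc_poly" where
  "letter_word v = Poly_Mapping.single (Word (map (Gen \<circ> Inl) v)) 1"

lemma monomial_simps:
  "letter_gen x * monomial k u g = monomial k (x # u) g"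
  "Poly_Mapping.single 0 k * group_gen g = monomial k [] g"
  "Poly_Mapping.single 0 l * monomial k u g = monomial (l * k) u g"
  "monomial k u g + monomial l u g = monomial (k + l) u g"
  "monomial 0 u g = 0"
  by (simp_all add: monomial_def gen_def mult_single plus_free_monoid_def zero_free_monoid_def
      single_add[symmetric])

lemma letter_word_simps:
  "letter_word [] = 1"
  "letter_word (x # v) = letter_gen x * letter_word v"
  "letter_word v * group_gen g = monomial 1 v g"
  by (simp_all add: letter_word_def monomial_def gen_def mult_single plus_free_monoid_def
      zero_free_monoid_def[symmetric])

lemma monomial_in_carrier [simp, intro]: "g \<in> carrier G \<Longrightarrow> monomial k u g \<in> nek_carrier"
  by (induction u)
     (simp_all flip: monomial_simps(1,2) add: nek_carrier_closed)

lemma letter_word_in_carrier [simp, intro]: "letter_word v \<in> nek_carrier"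
  by (induction v) (simp_all add: letter_word_simps)

lemma act_letter_one: "act_letter \<phi> \<one> x = x"
  by (simp add: act_letter_def act_one)

lemma section_at_unique:
  assumes "g \<in> carrier G" "h \<in> carrier G"
    and "\<And>w. \<phi> g (x # w) = act_letter \<phi> g x # \<phi> h w"
  shows "section_at G \<phi> g x = h"
proof -
  have "\<phi> (section_at G \<phi> g x) = \<phi> h"
    using assms section_at(2)[OF assms(1)] by (metis ext list.inject)
  then show ?thesis
    using faithful assms section_at(1) by (auto dest: inj_onD)
qed

lemma section_at_one: "section_at G \<phi> \<one> x = \<one>"
  by (rule section_at_unique) (simp_all add: act_one act_letter_one)

lemma adj_letter_monomial:
  assumes "g \<in> carrier G"
  shows "adj (letter_gen y) * monomial k (x # u) g \<doteq> (if x = y then monomial k u g else 0)"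
proof -
  have "adj (letter_gen y) * letter_gen x * monomial k u g
      \<doteq> (if x = y then 1 else 0) * monomial k u g"
    using assms by (intro nek_cong_rmult nek_relations) auto
  then show ?thesis
    by (cases "x = y") (simp_all add: mult.assoc monomial_simps)
qed

lemma monomial_letter:
  assumes "g \<in> carrier G"
  shows "monomial k u g * letter_gen x
    \<doteq> monomial k (u @ [act_letter \<phi> g x]) (section_at G \<phi> g x)"
proof (induction u)
  case Nil
  have "Poly_Mapping.single 0 k * (group_gen g * letter_gen x) \<doteq> Poly_Mapping.single 0 k *
      (letter_gen (act_letter \<phi> g x) * group_gen (section_at G \<phi> g x))"
    using assms by (intro nek_cong_lmult nek_relations) auto
  moreover have "Poly_Mapping.single 0 k *
      (letter_gen (act_letter \<phi> g x) * group_gen (section_at G \<phi> g x))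
      = monomial k [act_letter \<phi> g x] (section_at G \<phi> g x)"
    by (simp add: monomial_def gen_def mult_single plus_free_monoid_def zero_free_monoid_def)
  ultimately show ?case
    by (simp add: mult.assoc flip: monomial_simps(2))
next
  case (Cons y u)
  then have "letter_gen y * (monomial k u g * letter_gen x)
      \<doteq> letter_gen y * monomial k (u @ [act_letter \<phi> g x]) (section_at G \<phi> g x)"
    by (intro nek_cong_lmult) auto
  then show ?case by (simp add: monomial_simps flip: mult.assoc)
qed

lemma group_monomial:
  assumes "g \<in> carrier G" "h \<in> carrier G"
  shows "\<exists>v f. f \<in> carrier G \<and> length v = length u
    \<and> group_gen g * monomial k u h \<doteq> monomial k v f"
  using assms
proof (induction u arbitrary: g)
  case Nil
  have "Poly_Mapping.single 0 k * (group_gen g * group_gen h)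
      \<doteq> Poly_Mapping.single 0 k * group_gen (g \<otimes> h)"
    using Nil by (intro nek_cong_lmult nek_relations) auto
  moreover have "Poly_Mapping.single 0 k * (group_gen g * group_gen h)
      = group_gen g * monomial k [] h"
    by (simp add: monomial_def gen_def mult_single plus_free_monoid_def zero_free_monoid_def)
  ultimately show ?case
    using Nil by (intro exI[of _ "[]"] exI[of _ "g \<otimes> h"]) (simp add: monomial_simps)
next
  case (Cons x u)
  let ?s = "section_at G \<phi> g x"
  obtain v f where vf: "f \<in> carrier G" "length v = length u"
      "group_gen ?s * monomial k u h \<doteq> monomial k v f"
    using Cons section_at(1) by blast
  have "group_gen g * letter_gen x * monomial k u h
      \<doteq> letter_gen (act_letter \<phi> g x) * group_gen ?s * monomial k u h"
    using Cons.prems by (intro nek_cong_rmult nek_relations) auto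
  moreover have "letter_gen (act_letter \<phi> g x) * (group_gen ?s * monomial k u h)
      \<doteq> letter_gen (act_letter \<phi> g x) * monomial k v f"
    using vf by (intro nek_cong_lmult) auto
  ultimately have "group_gen g * monomial k (x # u) h \<doteq> monomial k (act_letter \<phi> g x # v) f"
    by (simp add: mult.assoc monomial_simps) (rule nek_cong_trans)
  then show ?case
    using vf by (intro exI[of _ "act_letter \<phi> g x # v"] exI[of _ f]) simp
qed

text \<open>An adjoint of a letter cancels the first letter of the word, a group element permutes the words of
  equal length and changes only the group element behind them.  So words of length at least \<open>n + 1\<close> allow one
  more generator and still leave words of length at least \<open>n\<close>.\<close>

lemma gen_monomial:
  fixes k :: "'k::field"
  assumes "gen_base s \<in> nekrashevych_generators G" "g \<in> carrier G" "Suc n \<le> length u"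
  shows "\<exists>l v h. h \<in> carrier G \<and> n \<le> length v
    \<and> Poly_Mapping.single (Word [s]) 1 * monomial k u g \<doteq> monomial l v h"
proof (cases s rule: gen_Sum_cases)
  case (letter x)
  then have "Poly_Mapping.single (Word [s]) 1 * monomial k u g = monomial k (x # u) g"
    by (simp flip: monomial_simps(1) add: gen_def)
  then show ?thesis
    using assms by (intro exI[of _ k] exI[of _ "x # u"] exI[of _ g]) auto
next
  case (letter_adj x)
  then have s: "Poly_Mapping.single (Word [s]) 1 = (adj (letter_gen x) :: ('x + 'g, 'k) nc_poly)"
    by (simp add: gen_def adj_single word_adj_def)
  obtain y v where u: "u = y # v" "n \<le> length v"
    using assms by (cases u) auto
  have "Poly_Mapping.single (Word [s]) 1 * monomial k u g \<doteq> monomial (if y = x then k else 0) v g"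
    using adj_letter_monomial[OF assms(2), of x k y v] by (auto simp: s u monomial_simps)
  then show ?thesis using u assms by blast
next
  case (group h)
  then have "h \<in> carrier G" using assms by (auto simp: nekrashevych_generators_def)
  then obtain v f where "f \<in> carrier G" "length v = length u"
      "group_gen h * monomial k u g \<doteq> monomial k v f"
    using group_monomial assms by blast
  then show ?thesis using group assms unfolding gen_def by (metis Suc_leD)
next
  case (group_adj h)
  then have h: "h \<in> carrier G" using assms by (auto simp: nekrashevych_generators_def)
  then have "adj (group_gen h) * monomial k u g \<doteq> group_gen (inv h) * monomial k u g"
    using assms by (intro nek_cong_rmult nek_relations) auto
  moreover obtain v f where "f \<in> carrier G" "length v = length u"
      "group_gen (inv h) * monomial k u g \<doteq> monomial k v f"
    using group_monomial[of "inv h"] assms h by blast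
  moreover have "Poly_Mapping.single (Word [s]) 1 = (adj (group_gen h) :: ('x + 'g, 'k) nc_poly)"
    using group_adj by (simp add: gen_def adj_single word_adj_def)
  ultimately show ?thesis using assms by (metis Suc_leD nek_cong_trans)
qed

text \<open>Reading \<open>s\<close> from right to left, each factor uses up at most one letter of \<open>v\<close>.\<close>

lemma word_absorbed:
  assumes "gen_base ` set s \<subseteq> nekrashevych_generators G" "length s + n \<le> length v"
  shows "\<exists>k u g. g \<in> carrier G \<and> n \<le> length u
    \<and> Poly_Mapping.single (Word s) 1 * letter_word v \<doteq> (monomial k u g :: ('x + 'g, 'k::field) nc_poly)"
  using assms
proof (induction s arbitrary: n)
  case Nil
  have "letter_word v * 1 \<doteq> letter_word v * group_gen \<one>"
    by (intro nek_cong_lmult nek_cong_sym[OF nek_relations(1)]) auto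
  then have "Poly_Mapping.single (Word []) 1 * letter_word v
      \<doteq> (monomial 1 v \<one> :: ('x + 'g, 'k) nc_poly)"
    by (simp add: letter_word_simps flip: zero_free_monoid_def)
  then show ?case using Nil by fastforce
next
  case (Cons t s)
  let ?t = "Poly_Mapping.single (Word [t]) 1 :: ('x + 'g, 'k) nc_poly"
  obtain k u g where kug: "g \<in> carrier G" "Suc n \<le> length u"
      "Poly_Mapping.single (Word s) 1 * letter_word v \<doteq> (monomial k u g :: ('x + 'g, 'k) nc_poly)"
    using Cons.IH[of "Suc n"] Cons.prems by auto
  obtain l w h where lwh: "h \<in> carrier G" "n \<le> length w" "?t * monomial k u g \<doteq> monomial l w h"
    using gen_monomial[of t g n u k] kug Cons.prems by auto
  have "?t \<in> nek_carrier"
    using Cons.prems by (simp add: nek_carrier_def free_star_algebra_def)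
  then have "?t * (Poly_Mapping.single (Word s) 1 * letter_word v) \<doteq> ?t * monomial k u g"
    using kug by (intro nek_cong_lmult)
  then have "Poly_Mapping.single (Word (t # s)) 1 * letter_word v \<doteq> monomial l w h"
    using nek_cong_trans[OF _ lwh(3)]
    by (simp add: mult_single plus_free_monoid_def flip: mult.assoc)
  then show ?case using lwh by blast
qed

text \<open>Lists, because the inductions below count entries, and because one step may produce the same
  monomial from several entries.\<close>

definition combination :: "('k::field \<times> 'x list \<times> 'g) list \<Rightarrow> ('x + 'g, 'k) nc_poly" where
  "combination L = (\<Sum>(k, u, g) \<leftarrow> L. monomial k u g)"

definition groups_in :: "'g set \<Rightarrow> ('k \<times> 'x list \<times> 'g) list \<Rightarrow> bool" where
  "groups_in A L \<longleftrightarrow> (\<forall>(k, u, g) \<in> set L. g \<in> A)"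

definition no_empty_word :: "('k \<times> 'x list \<times> 'g) list \<Rightarrow> bool" where
  "no_empty_word L \<longleftrightarrow> (\<forall>(k, u, g) \<in> set L. u \<noteq> [])"

lemma combination_simps [simp]:
  "combination [] = 0"
  "combination ((k, u, g) # L) = monomial k u g + combination L"
  "combination (L @ M) = combination L + combination M"
  by (simp_all add: combination_def)

lemma groups_in_simps [simp]:
  "groups_in A []" "groups_in A ((k, u, g) # L) \<longleftrightarrow> g \<in> A \<and> groups_in A L"
  by (simp_all add: groups_in_def)

lemma no_empty_word_simps [simp]:
  "no_empty_word []" "no_empty_word ((k, u, g) # L) \<longleftrightarrow> u \<noteq> [] \<and> no_empty_word L"
  by (simp_all add: no_empty_word_def)

lemma combination_in_carrier [simp, intro]: "groups_in (carrier G) L \<Longrightarrow> combination L \<in> nek_carrier"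
  by (induction L) auto

text \<open>The effect of multiplication with \<open>y\<^sup>*\<close> on the left (for nonempty words only) and with \<open>x\<close> on
  the right.\<close>

definition strip_letter :: "'x \<Rightarrow> ('k \<times> 'x list \<times> 'g) list \<Rightarrow> ('k \<times> 'x list \<times> 'g) list" where
  "strip_letter y L = map (\<lambda>(k, u, g). (k, tl u, g)) (filter (\<lambda>(k, u, g). hd u = y) L)"

definition push_letter :: "'x \<Rightarrow> ('k \<times> 'x list \<times> 'g) list \<Rightarrow> ('k \<times> 'x list \<times> 'g) list" where
  "push_letter x L =
     map (\<lambda>(k, u, g). (k, u @ [act_letter \<phi> g x], section_at G \<phi> g x)) L"

lemma combination_strip_letter:
  assumes "groups_in (carrier G) L" "no_empty_word L"
  shows "adj (letter_gen y) * combination L \<doteq> combination (strip_letter y L)"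
  using assms
proof (induction L)
  case Nil
  show ?case by (auto simp: strip_letter_def)
next
  case (Cons t L)
  obtain k x u g where t: "t = (k, x # u, g)"
    using Cons.prems by (cases t) (metis list.exhaust no_empty_word_simps(2))
  then have "adj (letter_gen y) * monomial k (x # u) g + adj (letter_gen y) * combination L
      \<doteq> (if x = y then monomial k u g else 0) + combination (strip_letter y L)"
    using Cons by (intro nek_cong_add adj_letter_monomial Cons.IH) auto
  then show ?case
    by (cases "x = y") (simp_all add: t strip_letter_def distrib_left)
qed

lemma combination_push_letter:
  assumes "groups_in (carrier G) L"
  shows "combination L * letter_gen x \<doteq> combination (push_letter x L)"
  using assms
proof (induction L)
  case Nil
  show ?case by (auto simp: push_letter_def)
next
  case (Cons t L)
  obtain k u g where t: "t = (k, u, g)" by (cases t)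
  then have "monomial k u g * letter_gen x + combination L * letter_gen x
      \<doteq> monomial k (u @ [act_letter \<phi> g x]) (section_at G \<phi> g x) + combination (push_letter x L)"
    using Cons by (intro nek_cong_add monomial_letter Cons.IH) auto
  then show ?case
    by (simp add: t push_letter_def distrib_right)
qed

lemma groups_in_strip_letter: "groups_in A L \<Longrightarrow> groups_in A (strip_letter y L)"
  by (auto simp: groups_in_def strip_letter_def)

lemma groups_in_push_letter:
  "groups_in A L \<Longrightarrow> (\<And>g. g \<in> A \<Longrightarrow> section_at G \<phi> g x \<in> B) \<Longrightarrow> groups_in B (push_letter x L)"
  by (auto simp: groups_in_def push_letter_def)

lemma no_empty_word_push_letter: "no_empty_word (push_letter x L)"
  by (auto simp: no_empty_word_def push_letter_def)

lemma corner_combination: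
  assumes "groups_in (carrier G) L"
  shows "adj (letter_gen y) * combination L * letter_gen x
    \<doteq> combination (strip_letter y (push_letter x L))"
proof -
  have o: "groups_in (carrier G) (push_letter x L)"
    using assms section_at(1) by (rule groups_in_push_letter)
  have "adj (letter_gen y) * (combination L * letter_gen x)
      \<doteq> adj (letter_gen y) * combination (push_letter x L)"
    using assms by (intro nek_cong_lmult combination_push_letter) auto
  also have "\<dots> \<doteq> combination (strip_letter y (push_letter x L))"
    using o no_empty_word_push_letter by (rule combination_strip_letter)
  finally show ?thesis by (simp add: mult.assoc)
qed

text \<open>Pushing a letter lengthens each word by one before a letter is stripped, so nonempty words stay
  nonempty; an entry whose word begins with a letter other than \<open>y\<close> disappears.\<close>

lemma corner_combination_no_empty_word:
  fixes x y :: 'x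
  assumes "groups_in (carrier G) R" "no_empty_word R"
  defines "R' \<equiv> strip_letter y (push_letter x R)"
  shows "groups_in (carrier G) R'" "no_empty_word R'" "length R' \<le> length R"
    and "R = (k, z # u, g) # Q \<Longrightarrow> y \<noteq> z \<Longrightarrow> length R' < length R"
proof -
  show "groups_in (carrier G) R'"
    unfolding R'_def using assms(1) section_at(1) by (intro groups_in_strip_letter groups_in_push_letter)
  show "no_empty_word R'"
    using assms(2) by (auto simp: R'_def no_empty_word_def strip_letter_def push_letter_def)
  show "length R' \<le> length R"
    by (auto simp: R'_def strip_letter_def push_letter_def intro: le_trans[OF length_filter_le])
  assume "R = (k, z # u, g) # Q" "y \<noteq> z"
  then show "length R' < length R"
    by (auto simp: R'_def strip_letter_def push_letter_def less_Suc_eq_le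
        intro: le_trans[OF length_filter_le])
qed

lemma ex_word_right:
  assumes "p \<in> nek_carrier" "p \<notin> nek_ideal"
  shows "\<exists>v. length v = n \<and> p * letter_word v \<notin> nek_ideal"
  using assms
proof (induction n arbitrary: p)
  case 0
  then show ?case by (simp add: letter_word_simps)
next
  case (Suc n)
  obtain x where "p * letter_gen x \<notin> nek_ideal"
    using ex_letter_right Suc.prems by blast
  then obtain v where "length v = n" "p * letter_gen x * letter_word v \<notin> nek_ideal"
    using Suc by blast
  then show ?case
    by (intro exI[of _ "x # v"]) (simp add: letter_word_simps mult.assoc)
qed

lemma ex_combination:
  fixes p :: "('x + 'g, 'k::field) nc_poly"
  assumes p: "p \<in> nek_carrier"
    and n: "\<And>u. u \<in> Poly_Mapping.keys p \<Longrightarrow> length (letters u) \<le> length v"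
  shows "\<exists>L. groups_in (carrier G) L \<and> p * letter_word v \<doteq> combination L"
proof -
  have "\<exists>L. groups_in (carrier G) L \<and>
      (\<Sum>u \<in> A. Poly_Mapping.single u (Poly_Mapping.lookup p u)) * letter_word v \<doteq> combination L"
    if "finite A" "A \<subseteq> Poly_Mapping.keys p" for A
    using that
  proof (induction A)
    case empty
    show ?case by (intro exI[of _ "[]"]) auto
  next
    case (insert u A)
    then obtain L where L: "groups_in (carrier G) L"
      "(\<Sum>u \<in> A. Poly_Mapping.single u (Poly_Mapping.lookup p u)) * letter_word v \<doteq> combination L"
      by auto
    let ?c = "Poly_Mapping.lookup p u"
    have "gen_base ` set (letters u) \<subseteq> nekrashevych_generators G"
      using p insert.prems by (auto simp: nek_carrier_def free_star_algebra_def)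
    then obtain l w h where h: "h \<in> carrier G" "Poly_Mapping.single (Word (letters u)) 1 * letter_word v
        \<doteq> (monomial l w h :: ('x + 'g, 'k) nc_poly)"
      using word_absorbed[of "letters u" 0 v] n insert.prems by auto
    have "Poly_Mapping.single 0 ?c * (Poly_Mapping.single u 1 * letter_word v)
        \<doteq> Poly_Mapping.single 0 ?c * monomial l w h"
      using h by (intro nek_cong_lmult) auto
    then have "Poly_Mapping.single u ?c * letter_word v \<doteq> monomial (?c * l) w h"
      by (simp add: monomial_simps mult_single flip: mult.assoc)
    then have "Poly_Mapping.single u ?c * letter_word v
        + (\<Sum>u \<in> A. Poly_Mapping.single u (Poly_Mapping.lookup p u)) * letter_word v
        \<doteq> combination ((?c * l, w, h) # L)"
      using L by (simp add: nek_cong_add)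
    then show ?case
      using insert L h by (intro exI[of _ "(?c * l, w, h) # L"]) (simp add: distrib_right)
  qed
  then show ?thesis
    using nc_poly_eq_sum_single[of p] by (metis finite_keys order_refl)
qed

text \<open>An ideal that contains such an element is the whole algebra.\<close>

definition generates_one :: "('x + 'g, 'k::field) nc_poly \<Rightarrow> bool" where
  "generates_one p \<longleftrightarrow> (\<exists>b \<in> nek_carrier. \<exists>c \<in> nek_carrier. b * p * c \<doteq> 1)"

lemma generates_one_cong:
  assumes "p \<doteq> q" "generates_one q"
  shows "generates_one p"
proof -
  obtain b c where bc: "b \<in> nek_carrier" "c \<in> nek_carrier" "b * q * c \<doteq> 1"
    using assms by (auto simp: generates_one_def)
  have "b * p * c \<doteq> b * q * c"
    using assms bc by (intro nek_cong_rmult nek_cong_lmult)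
  then show ?thesis using bc nek_cong_trans unfolding generates_one_def by blast
qed

lemma generates_one_mult:
  assumes "b \<in> nek_carrier" "c \<in> nek_carrier" "generates_one (b * p * c)"
  shows "generates_one p"
proof -
  obtain b' c' where *: "b' \<in> nek_carrier" "c' \<in> nek_carrier" "b' * (b * p * c) * c' \<doteq> 1"
    using assms by (auto simp: generates_one_def)
  then show ?thesis
    using assms unfolding generates_one_def
    by (intro bexI[of _ "b' * b"] bexI[of _ "c * c'"]) (auto simp: mult.assoc)
qed

text \<open>Since there are two letters, some \<open>y\<close> differs from the first letter of the first entry of
  \<open>R\<close>, and the corner \<open>y\<^sup>* _ y\<close> fixes scalars but kills this entry.\<close>

lemma scalar_plus_tail:
  assumes "k \<noteq> 0" "groups_in (carrier G) R" "no_empty_word R"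
  shows "generates_one (monomial k [] \<one> + combination R)"
  using assms
proof (induction "length R" arbitrary: R rule: less_induct)
  case less
  show ?case
  proof (cases R)
    case Nil
    have "Poly_Mapping.single 0 (inverse k) * monomial k [] \<one> = group_gen \<one>"
      using \<open>k \<noteq> 0\<close> by (simp add: monomial_simps) (simp add: monomial_def gen_def)
    then have "Poly_Mapping.single 0 (inverse k) * (monomial k [] \<one> + combination R) * 1 \<doteq> 1"
      using nek_relations(1) Nil by simp
    then show ?thesis unfolding generates_one_def by blast
  next
    case (Cons t Q)
    obtain l z u g where t: "t = (l, z # u, g)"
      using Cons less.prems by (cases t) (metis list.exhaust no_empty_word_simps(2))
    have "(UNIV :: 'x set) \<noteq> {z}"
    proof
      assume "(UNIV :: 'x set) = {z}"
      then have "card (UNIV :: 'x set) = 1"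
        by (metis is_singletonI is_singleton_altdef)
      then show False using alphabet by simp
    qed
    then obtain y where y: "y \<noteq> z" by blast
    define R' where "R' = strip_letter y (push_letter y R)"
    have R': "groups_in (carrier G) R'" "no_empty_word R'" "length R' < length R"
      using corner_combination_no_empty_word[of R] less.prems Cons t y unfolding R'_def by blast+
    have "adj (letter_gen y) * combination ((k, [], \<one>) # R) * letter_gen y
        \<doteq> combination (strip_letter y (push_letter y ((k, [], \<one>) # R)))"
      using less.prems by (intro corner_combination) simp
    then have "adj (letter_gen y) * (monomial k [] \<one> + combination R) * letter_gen y
        \<doteq> monomial k [] \<one> + combination R'"
      by (simp add: R'_def strip_letter_def push_letter_def act_letter_one section_at_one)
    moreover have "generates_one (monomial k [] \<one> + combination R')"
      using R' less by blast
    ultimately show ?thesis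
      by (meson generates_one_cong generates_one_mult letter_in_carrier nek_carrier_closed(7))
  qed
qed

text \<open>Only corners \<open>y\<^sup>* _ x\<close> with one letter on each side are admitted, so that the monomials with nonempty
  words stay separate from the scalar that is being produced.\<close>

inductive compresses_to_scalar :: "('x + 'g, 'k::field) nc_poly \<Rightarrow> bool" where
  scalar: "k \<noteq> 0 \<Longrightarrow> e \<doteq> monomial k [] \<one> \<Longrightarrow> compresses_to_scalar e"
| corner: "e \<in> nek_carrier \<Longrightarrow> compresses_to_scalar (adj (letter_gen y) * e * letter_gen x)
    \<Longrightarrow> compresses_to_scalar e"

lemma compresses_to_scalar_cong:
  assumes "compresses_to_scalar e" "e' \<doteq> e"
  shows "compresses_to_scalar e'"
  using assms
proof (induction arbitrary: e')
  case (scalar k e)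
  then show ?case using compresses_to_scalar.scalar nek_cong_trans by blast
next
  case (corner e y x)
  have "adj (letter_gen y) * e' * letter_gen x \<doteq> adj (letter_gen y) * e * letter_gen x"
    using corner.prems by (intro nek_cong_rmult nek_cong_lmult) auto
  then show ?case
    using corner.IH corner.prems compresses_to_scalar.corner nek_cong_carrier(1) by blast
qed

lemma compressible_plus_tail:
  assumes "compresses_to_scalar e" "groups_in (carrier G) R" "no_empty_word R"
  shows "generates_one (e + combination R)"
  using assms
proof (induction arbitrary: R)
  case (scalar k e)
  have "e + combination R \<doteq> monomial k [] \<one> + combination R"
    using scalar by (intro nek_cong_add) auto
  then show ?case
    using scalar_plus_tail scalar generates_one_cong by blast
next
  case (corner e y x)
  define R' where "R' = strip_letter y (push_letter x R)"
  have "adj (letter_gen y) * e * letter_gen x + adj (letter_gen y) * combination R * letter_gen x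
      \<doteq> adj (letter_gen y) * e * letter_gen x + combination R'"
    unfolding R'_def using corner by (intro nek_cong_add corner_combination) auto
  then have "adj (letter_gen y) * (e + combination R) * letter_gen x
      \<doteq> adj (letter_gen y) * e * letter_gen x + combination R'"
    by (simp add: algebra_simps)
  moreover have "generates_one (adj (letter_gen y) * e * letter_gen x + combination R')"
    using corner corner_combination_no_empty_word unfolding R'_def by blast
  ultimately show ?case
    by (meson generates_one_cong generates_one_mult letter_in_carrier nek_carrier_closed(7))
qed

text \<open>All sections of \<open>g\<close> at words of length \<open>n\<close> lie in \<open>A\<close>.\<close>

primrec sections_reach :: "'g set \<Rightarrow> nat \<Rightarrow> 'g \<Rightarrow> bool" where
  "sections_reach A 0 g \<longleftrightarrow> g \<in> A"
| "sections_reach A (Suc n) g \<longleftrightarrow> (\<forall>x. sections_reach A n (section_at G \<phi> g x))"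

lemma sections_reach_mono:
  assumes "\<And>g x. g \<in> A \<Longrightarrow> section_at G \<phi> g x \<in> A" "sections_reach A m g" "m \<le> n"
  shows "sections_reach A n g"
proof -
  have "sections_reach A (Suc n) g" if "sections_reach A n g" for n g
    using that assms(1) by (induction n arbitrary: g) auto
  then show ?thesis
    using assms(2,3) by (induction n) (auto simp: le_Suc_eq)
qed

text \<open>Either the part formed by the entries with empty word is nonzero, and then it compresses to a
  scalar; or this part can be dropped, and stripping a letter from the others shortens all words.\<close>

lemma combination_nucleus_generates_one:
  fixes L :: "('k::field \<times> 'x list \<times> 'g) list"
  assumes A: "A \<subseteq> carrier G"
    and comp: "\<And>E :: ('k \<times> 'x list \<times> 'g) list. groups_in A E \<Longrightarrow> (\<And>k u g. (k, u, g) \<in> set E \<Longrightarrow> u = [])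
      \<Longrightarrow> combination E \<notin> nek_ideal \<Longrightarrow> compresses_to_scalar (combination E)"
    and L: "groups_in A L" "combination L \<notin> nek_ideal"
  shows "generates_one (combination L)"
  using L
proof (induction "\<Sum>(k, u, g) \<leftarrow> L. Suc (length u)" arbitrary: L rule: less_induct)
  case less
  define E where "E = filter (\<lambda>(k, u, g). u = []) L"
  define R where "R = filter (\<lambda>(k, u, g). u \<noteq> []) L"
  have split: "combination L = combination E + combination R"
    unfolding E_def R_def by (induction L) (auto simp: algebra_simps)
  have E: "groups_in A E" "\<And>k u g. (k, u, g) \<in> set E \<Longrightarrow> u = []"
    and R: "groups_in A R" "no_empty_word R"
    using less.prems by (auto simp: E_def R_def groups_in_def no_empty_word_def)
  have oG: "groups_in A M \<Longrightarrow> groups_in (carrier G) M" for M :: "('k \<times> 'x list \<times> 'g) list"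
    using A by (auto simp: groups_in_def)
  show ?case
  proof (cases "combination E \<in> nek_ideal")
    case False
    then show ?thesis
      using compressible_plus_tail comp E R oG unfolding split by blast
  next
    case True
    have "combination E + combination R \<doteq> 0 + combination R"
      using True oG R by (intro nek_cong_add) (auto simp: nek_cong_zero_iff)
    then have LR: "combination L \<doteq> combination R" by (simp add: split)
    then have "combination R \<notin> nek_ideal"
      using less.prems nek_cong_ideal_iff by blast
    moreover from this have "R \<noteq> []" using nek_ideal_closed(1) by auto
    ultimately obtain y where y: "adj (letter_gen y) * combination R \<notin> nek_ideal"
      using ex_letter_left R oG by blast
    define L' where "L' = strip_letter y R"
    have L': "groups_in A L'" "adj (letter_gen y) * combination R \<doteq> combination L'"
      unfolding L'_def using R oG by (auto intro: groups_in_strip_letter combination_strip_letter)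
    have smaller: "M \<noteq> [] \<Longrightarrow> no_empty_word M \<Longrightarrow>
      (\<Sum>(k, u, g) \<leftarrow> strip_letter y M. Suc (length u)) < (\<Sum>(k, u, g) \<leftarrow> M. Suc (length u))"
      for M :: "('k \<times> 'x list \<times> 'g) list"
    proof (induction M)
      case (Cons t M)
      then show ?case
        by (cases t; cases "M = []") (auto simp: strip_letter_def)
    qed simp
    have "(\<Sum>(k, u, g) \<leftarrow> L'. Suc (length u)) < (\<Sum>(k, u, g) \<leftarrow> R. Suc (length u))"
      unfolding L'_def using \<open>R \<noteq> []\<close> R by (intro smaller)
    also have "\<dots> \<le> (\<Sum>(k, u, g) \<leftarrow> L. Suc (length u))"
      unfolding R_def by (induction L) auto
    finally have "generates_one (combination L')"
      using less L' y nek_cong_ideal_iff by blast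
    then have "generates_one (adj (letter_gen y) * combination R * 1)"
      using L' generates_one_cong by simp
    then have "generates_one (combination R)"
      by (rule generates_one_mult[rotated 2]) auto
    then show ?thesis using LR generates_one_cong by blast
  qed
qed

text \<open>The set \<open>A\<close> contains the nucleus.  By the last hypothesis the algebra detects on the span of \<open>A\<close>,
  by finitely many corners, whether an element is zero.\<close>

theorem simple_nekrashevych_algebra:
  assumes A: "A \<subseteq> carrier G"
    and closed: "\<And>g x. g \<in> A \<Longrightarrow> section_at G \<phi> g x \<in> A"
    and contracting: "\<And>g. g \<in> carrier G \<Longrightarrow> \<exists>n. sections_reach A n g"
    and comp: "\<And>E :: ('k \<times> 'x list \<times> 'g) list. groups_in A E \<Longrightarrow> (\<And>k u g. (k, u, g) \<in> set E \<Longrightarrow> u = [])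
      \<Longrightarrow> combination E \<notin> nek_ideal \<Longrightarrow> compresses_to_scalar (combination E)"
  shows "simple_algebra (nekrashevych_algebra TYPE('k::field) G \<phi>)"
proof -
  let ?F = "free_star_algebra (nekrashevych_generators G) :: ('x + 'g, 'k) nc_poly ring"
  let ?J = "nek_ideal :: ('x + 'g, 'k) nc_poly set"
  have reduce: "generates_one (combination L)"
    if "groups_in (carrier G) L" "\<And>k u g. (k, u, g) \<in> set L \<Longrightarrow> sections_reach A n g"
      "combination L \<notin> nek_ideal" for n and L :: "('k \<times> 'x list \<times> 'g) list"
    using that
  proof (induction n arbitrary: L)
    case 0
    then have "groups_in A L" by (auto simp: groups_in_def)
    then show ?case using combination_nucleus_generates_one[OF A comp] 0 by blast
  next
    case (Suc n)
    obtain x where x: "combination L * letter_gen x \<notin> nek_ideal"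
      using ex_letter_right Suc.prems by blast
    have L': "combination L * letter_gen x \<doteq> combination (push_letter x L)"
      using Suc.prems by (intro combination_push_letter)
    have "generates_one (combination (push_letter x L))"
    proof (rule Suc.IH)
      show "groups_in (carrier G) (push_letter x L)"
        using Suc.prems(1) section_at(1) by (rule groups_in_push_letter)
      show "combination (push_letter x L) \<notin> nek_ideal"
        using L' x nek_cong_ideal_iff by blast
      fix k u g assume "(k, u, g) \<in> set (push_letter x L)"
      then show "sections_reach A n g"
        using Suc.prems(2) by (fastforce simp: push_letter_def)
    qed
    then have "generates_one (1 * combination L * letter_gen x)"
      using L' generates_one_cong by simp
    then show ?case by (rule generates_one_mult[rotated 2]) auto
  qed
  have one: "generates_one p" if p: "p \<in> nek_carrier" "p \<notin> nek_ideal" for p :: "('x + 'g, 'k) nc_poly"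
  proof -
    define n where "n = Max (insert 0 ((length \<circ> letters) ` Poly_Mapping.keys p))"
    have n: "length (letters u) \<le> n" if "u \<in> Poly_Mapping.keys p" for u
      using that unfolding n_def by (intro Max_ge) auto
    obtain v where v: "length v = n" "p * letter_word v \<notin> nek_ideal"
      using ex_word_right p by blast
    obtain L where L: "groups_in (carrier G) L" "p * letter_word v \<doteq> combination L"
      using ex_combination[of p v] p n v by auto
    have "\<exists>m. \<forall>(k, u, g) \<in> set M. sections_reach A m g"
      if "groups_in (carrier G) M" for M :: "('k \<times> 'x list \<times> 'g) list"
      using that
    proof (induction M)
      case (Cons t M)
      obtain k u g where t: "t = (k, u, g)" by (cases t)
      obtain m where m: "\<forall>(k, u, g) \<in> set M. sections_reach A m g"
        using Cons t by auto
      obtain m' where m': "sections_reach A m' g"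
        using Cons.prems t contracting by auto
      show ?case
        using sections_reach_mono[OF closed] m m' t
        by (intro exI[of _ "max m m'"]) (fastforce dest: bspec)
    qed simp
    then obtain m where "\<forall>(k, u, g) \<in> set L. sections_reach A m g"
      using L by blast
    then have "generates_one (combination L)"
      using reduce[of L m] L v nek_cong_ideal_iff by blast
    then have "generates_one (1 * p * letter_word v)"
      using L generates_one_cong by simp
    then show ?thesis by (rule generates_one_mult[rotated 2]) auto
  qed
  interpret J: ideal ?J ?F by (rule ideal_nek)
  interpret Q: ring "?F Quot ?J" by (rule J.quotient_is_ring)
  interpret h: ring_hom_ring ?F "?F Quot ?J" "(+>\<^bsub>?F\<^esub>) ?J" by (rule J.rcos_ring_hom_ring)
  have alg: "nekrashevych_algebra TYPE('k) G \<phi> = ?F Quot ?J"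
    by (simp add: nekrashevych_algebra_def nek_ideal_def)
  have zero: "\<zero>\<^bsub>?F Quot ?J\<^esub> = ?J" by (simp add: FactRing_def)
  have coset_zero: "?J +>\<^bsub>?F\<^esub> p = ?J \<longleftrightarrow> p \<in> ?J" if "p \<in> carrier ?F" for p
    using that J.a_rcos_const J.rcos_const_imp_mem by blast
  have "?J +>\<^bsub>?F\<^esub> 1 \<noteq> ?J"
    using coset_zero[of 1] one_notin_nek_ideal by (simp add: free_star_algebra_closed)
  then have nonzero: "carrier (?F Quot ?J) \<noteq> {\<zero>\<^bsub>?F Quot ?J\<^esub>}"
    using h.hom_closed[of 1] zero by (auto simp: free_star_algebra_closed)
  have "I = carrier (?F Quot ?J)" if I: "ideal I (?F Quot ?J)" and "I \<noteq> {\<zero>\<^bsub>?F Quot ?J\<^esub>}" for I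
  proof -
    interpret I: ideal I "?F Quot ?J" by (rule I)
    have "\<zero>\<^bsub>?F Quot ?J\<^esub> \<in> I"
      by (rule additive_subgroup.zero_closed[OF I.is_additive_subgroup])
    then obtain C where C: "C \<in> I" "C \<noteq> ?J" using \<open>I \<noteq> {\<zero>\<^bsub>?F Quot ?J\<^esub>}\<close> zero by auto
    then obtain p where p: "p \<in> carrier ?F" "C = ?J +>\<^bsub>?F\<^esub> p"
      using I.Icarr by (auto simp: FactRing_def A_RCOSETS_def')
    then have "p \<notin> ?J" using C coset_zero by blast
    then obtain b c where bc: "b \<in> nek_carrier" "c \<in> nek_carrier" "b * p * c \<doteq> 1"
      using one[of p] p unfolding generates_one_def nek_carrier_def by blast
    let ?q = "\<lambda>r. ?J +>\<^bsub>?F\<^esub> r"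
    have carr: "b \<in> carrier ?F" "c \<in> carrier ?F" using bc by (simp_all add: nek_carrier_def)
    have "?q b \<otimes>\<^bsub>?F Quot ?J\<^esub> C \<otimes>\<^bsub>?F Quot ?J\<^esub> ?q c \<in> I"
      using C carr by (intro I.I_l_closed I.I_r_closed) auto
    also have "?q b \<otimes>\<^bsub>?F Quot ?J\<^esub> C \<otimes>\<^bsub>?F Quot ?J\<^esub> ?q c = ?q (b * p * c)"
      using carr p h.hom_mult[of b p] h.hom_mult[of "b * p" c]
      by (simp add: free_star_algebra_closed2)
    also have "\<dots> = ?q 1"
    proof -
      have "b * p * c = (b * p * c - 1) \<oplus>\<^bsub>?F\<^esub> 1" by simp
      then have "?q (b * p * c) = ?q (b * p * c - 1) \<oplus>\<^bsub>?F Quot ?J\<^esub> ?q 1"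
        using bc by (metis J.Icarr free_star_algebra_closed(1) h.hom_add nek_cong_def)
      also have "?q (b * p * c - 1) = \<zero>\<^bsub>?F Quot ?J\<^esub>"
        using bc J.a_rcos_const zero by (simp add: nek_cong_def)
      finally show ?thesis using h.hom_closed[of 1] by (simp add: free_star_algebra_closed)
    qed
    also have "\<dots> = \<one>\<^bsub>?F Quot ?J\<^esub>" using h.hom_one by simp
    finally show ?thesis by (rule I.one_imp_carrier)
  qed
  then show ?thesis using nonzero unfolding simple_algebra_def alg by blast
qed


lemma act_letter_mult:
  assumes "g \<in> carrier G" "h \<in> carrier G"
  shows "act_letter \<phi> (g \<otimes> h) x = act_letter \<phi> g (act_letter \<phi> h x)"
proof -
  have "\<phi> (g \<otimes> h) [x] = act_letter \<phi> g (act_letter \<phi> h x)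
      # \<phi> (section_at G \<phi> g (act_letter \<phi> h x)) (\<phi> (section_at G \<phi> h x) [])"
    by (simp add: act_mult assms section_at(2)[OF assms(1)] section_at(2)[OF assms(2)])
  then show ?thesis by (simp only: act_letter_def[of _ "g \<otimes> h"] list.sel(1))
qed

lemma section_at_mult:
  assumes "g \<in> carrier G" "h \<in> carrier G"
  shows "section_at G \<phi> (g \<otimes> h) x
    = section_at G \<phi> g (act_letter \<phi> h x) \<otimes> section_at G \<phi> h x"
  by (rule section_at_unique)
     (simp_all add: assms act_mult act_letter_mult section_at(1)
       section_at(2)[OF assms(1)] section_at(2)[OF assms(2)])

text \<open>Indexing the coefficients by positions covers lists \<open>gs\<close> with repetitions as well.\<close>

lemma combination_of_group_elements:
  fixes E :: "('k::field \<times> 'x list \<times> 'g) list"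
  assumes "groups_in (set gs) E" "\<And>k u g. (k, u, g) \<in> set E \<Longrightarrow> u = []"
  shows "\<exists>\<kappa>. combination E = (\<Sum>i < length gs. monomial (\<kappa> i) [] (gs ! i))"
  using assms
proof (induction E)
  case Nil
  show ?case by (intro exI[of _ "\<lambda>_. 0"]) (simp add: monomial_simps)
next
  case (Cons t E)
  obtain k u g where t: "t = (k, u, g)" by (cases t)
  obtain \<kappa> where \<kappa>: "combination E = (\<Sum>i < length gs. monomial (\<kappa> i) [] (gs ! i))"
    using Cons t by auto
  obtain j where j: "j < length gs" "gs ! j = g"
    using Cons.prems t by (auto simp: in_set_conv_nth)
  have "monomial k [] g = (\<Sum>i < length gs. monomial (if i = j then k else 0) [] (gs ! i))"
    using j by (simp add: if_distrib[of "\<lambda>l. monomial l _ _"] monomial_simps cong: if_cong)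
  then have "combination (t # E)
      = (\<Sum>i < length gs. monomial ((if i = j then k else 0) + \<kappa> i) [] (gs ! i))"
    using Cons.prems(2)[of k u g] t \<kappa>
    by (simp add: monomial_simps(4)[symmetric] sum.distrib)
  then show ?case by (rule exI[of _ "\<lambda>i. (if i = j then k else 0) + \<kappa> i"])
qed

end

section \<open>The nucleus of the Basilica group\<close>

interpretation B: self_similar_group basilica "\<lambda>g. g"
  by (rule self_similar_basilica)

abbreviation "act \<equiv> act_letter (\<lambda>g :: bool list \<Rightarrow> bool list. g)"
abbreviation "sect \<equiv> section_at basilica (\<lambda>g. g)"

fun basilica_a_inv basilica_c_inv :: "bool list \<Rightarrow> bool list" where
  "basilica_a_inv [] = []"
| "basilica_a_inv (False # w) = False # w"
| "basilica_a_inv (True # w) = True # basilica_c_inv w"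
| "basilica_c_inv [] = []"
| "basilica_c_inv (True # w) = False # w"
| "basilica_c_inv (False # w) = True # basilica_a_inv w"

lemma basilica_inv_cancel_apply:
  "basilica_a (basilica_a_inv w) = w \<and> basilica_a_inv (basilica_a w) = w
    \<and> basilica_c (basilica_c_inv w) = w \<and> basilica_c_inv (basilica_c w) = w"
proof (induction w)
  case (Cons x w)
  then show ?case by (cases x) auto
qed simp

lemma basilica_inv_cancel:
  "basilica_a \<circ> basilica_a_inv = id" "basilica_a_inv \<circ> basilica_a = id"
  "basilica_c \<circ> basilica_c_inv = id" "basilica_c_inv \<circ> basilica_c = id"
  by (simp_all add: fun_eq_iff basilica_inv_cancel_apply)

lemma basilica_inv_cancel_left:
  "basilica_a \<circ> (basilica_a_inv \<circ> f) = f" "basilica_a_inv \<circ> (basilica_a \<circ> f) = f"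
  "basilica_c \<circ> (basilica_c_inv \<circ> f) = f" "basilica_c_inv \<circ> (basilica_c \<circ> f) = f"
  by (simp_all add: fun_eq_iff basilica_inv_cancel_apply)

lemma inv_basilica:
  "Hilbert_Choice.inv basilica_a = basilica_a_inv"
  "Hilbert_Choice.inv basilica_c = basilica_c_inv"
  by (simp_all add: inv_unique_comp basilica_inv_cancel)

lemma basilica_inv_in: "basilica_a_inv \<in> carrier basilica" "basilica_c_inv \<in> carrier basilica"
  using inv_in_basilica basilica_gens_in inv_basilica by metis+

lemmas in_basilica = basilica_gens_in basilica_inv_in id_in_basilica comp_in_basilica

lemma act_basilica:
  "act id x = x" "act basilica_a x = x" "act basilica_a_inv x = x"
  "act basilica_c x = (\<not> x)" "act basilica_c_inv x = (\<not> x)"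
  by (cases x; simp add: act_letter_def)+

lemma sect_basilica:
  "sect id x = id"
  "sect basilica_a False = id" "sect basilica_a True = basilica_c"
  "sect basilica_a_inv False = id" "sect basilica_a_inv True = basilica_c_inv"
  "sect basilica_c False = id" "sect basilica_c True = basilica_a"
  "sect basilica_c_inv False = basilica_a_inv" "sect basilica_c_inv True = id"
  by (rule B.section_at_unique; simp add: in_basilica act_letter_def)+

lemma act_sect_comp:
  assumes "g \<in> carrier basilica" "h \<in> carrier basilica"
  shows "act (g \<circ> h) x = act g (act h x)"
    and "sect (g \<circ> h) x = sect g (act h x) \<circ> sect h x"
  using assms B.act_letter_mult[of g h x] B.section_at_mult[of g h x] B.section_at(1)
  by (simp_all add: mult_basilica)

lemmas basilica_sections_simps = act_basilica sect_basilica act_sect_comp in_basilica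
  basilica_inv_cancel basilica_inv_cancel_left comp_assoc

definition basilica_nucleus :: "(bool list \<Rightarrow> bool list) list" where
  "basilica_nucleus = [id, basilica_a, basilica_a_inv, basilica_c, basilica_c_inv,
     basilica_a \<circ> basilica_c_inv, basilica_c \<circ> basilica_a_inv]"

lemma nucleus_in_basilica: "set basilica_nucleus \<subseteq> carrier basilica"
  by (auto simp: basilica_nucleus_def in_basilica simp del: comp_apply)

lemma nucleus_closed: "g \<in> set basilica_nucleus \<Longrightarrow> sect g x \<in> set basilica_nucleus"
  by (cases x) (auto simp: basilica_nucleus_def basilica_sections_simps)

text \<open>The identity is included because it is a section of each generator.\<close>

definition basilica_letters :: "(bool list \<Rightarrow> bool list) set" where
  "basilica_letters = {id, basilica_a, basilica_a_inv, basilica_c, basilica_c_inv}"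

lemma letters_in_basilica: "basilica_letters \<subseteq> carrier basilica"
  by (auto simp: basilica_letters_def in_basilica)

lemma letters_closed: "s \<in> basilica_letters \<Longrightarrow> sect s x \<in> basilica_letters"
  by (cases x) (auto simp: basilica_letters_def sect_basilica)

text \<open>The finite computation behind contraction: after two levels, a product of a letter with an
  element of the nucleus is back in the nucleus.  For example,
  \<open>a (a c\<^sup>-\<^sup>1)\<close> has the section \<open>c c a\<^sup>-\<^sup>1\<close> at \<open>0\<close>, which has the sections \<open>a\<close> and \<open>a c\<^sup>-\<^sup>1\<close>.\<close>

lemma letter_times_nucleus:
  assumes "s \<in> basilica_letters" "h \<in> set basilica_nucleus"
  shows "B.sections_reach (set basilica_nucleus) 2 (s \<circ> h)"
  using assms unfolding basilica_letters_def basilica_nucleus_def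
  by (auto simp: numeral_2_eq_2 all_bool_eq basilica_sections_simps)

text \<open>Sections of letters are letters, so the sections of \<open>s h\<close> at words of length \<open>n\<close> are
  products of a letter with a section of \<open>h\<close>.\<close>

lemma letter_times_reaching:
  assumes "s \<in> basilica_letters" "h \<in> carrier basilica"
    "B.sections_reach (set basilica_nucleus) n h"
  shows "B.sections_reach (set basilica_nucleus) (n + 2) (s \<circ> h)"
  using assms
proof (induction n arbitrary: s h)
  case 0
  then show ?case using letter_times_nucleus by (simp only: add_0 B.sections_reach.simps(1))
next
  case (Suc n)
  have "B.sections_reach (set basilica_nucleus) (n + 2) (sect (s \<circ> h) x)" for x
  proof -
    have "sect (s \<circ> h) x = sect s (act h x) \<circ> sect h x"
      using Suc.prems letters_in_basilica by (intro act_sect_comp) auto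
    moreover have "B.sections_reach (set basilica_nucleus) (n + 2) (sect s (act h x) \<circ> sect h x)"
      using Suc.prems by (intro Suc.IH letters_closed B.section_at(1)) auto
    ultimately show ?thesis by (simp only:)
  qed
  then show ?case by (simp only: add_Suc B.sections_reach.simps(2) simp_thms)
qed

lemma basilica_contracting:
  assumes "g \<in> carrier basilica"
  shows "\<exists>n. B.sections_reach (set basilica_nucleus) n g"
proof -
  let ?P = "\<lambda>g. \<exists>n. B.sections_reach (set basilica_nucleus) n g"
  have letter: "?P (s \<circ> h)" if "s \<in> basilica_letters" "h \<in> carrier basilica" "?P h" for s h
    using letter_times_reaching that by blast
  \<comment> \<open>With an arbitrary \<open>h\<close> the claim passes to products: the factors of
    \<open>g1 \<circ> g2\<close> are put in front of \<open>h\<close> one after the other.\<close>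
  have "\<forall>h \<in> carrier basilica. ?P h \<longrightarrow> ?P (g \<circ> h)"
    using assms unfolding carrier_basilica
  proof (induction rule: generate.induct)
    case one
    then show ?case by (simp add: BijGroup_def restrict_def comp_def)
  next
    case (incl s)
    then have "s \<in> basilica_letters" by (auto simp: basilica_letters_def)
    then show ?case using letter unfolding carrier_basilica by blast
  next
    case (inv s)
    then have "inv\<^bsub>BijGroup UNIV\<^esub> s \<in> basilica_letters"
      using bij_basilica by (auto simp: inv_BijGroup_UNIV inv_basilica basilica_letters_def)
    then show ?case using letter unfolding carrier_basilica by blast
  next
    case (eng g1 g2)
    then have "g1 \<otimes>\<^bsub>BijGroup UNIV\<^esub> g2 = g1 \<circ> g2"
      by (intro mult_BijGroup_UNIV bij_of_basilica) (simp_all add: carrier_basilica)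
    moreover have "?P ((g1 \<circ> g2) \<circ> h)"
      if "h \<in> generate (BijGroup UNIV) {basilica_a, basilica_c}" "?P h" for h
    proof -
      have "?P (g1 \<circ> (g2 \<circ> h))"
        using eng that comp_in_basilica[unfolded carrier_basilica] by blast
      then show ?thesis by (simp only: comp_assoc)
    qed
    ultimately show ?case by (simp only: simp_thms ball_simps) blast
  qed
  moreover have "?P id"
    by (rule exI[of _ 0]) (simp add: basilica_nucleus_def)
  ultimately show ?thesis
    using id_in_basilica by fastforce
qed

section \<open>Compression of the span of the nucleus\<close>

definition nucleus_sum ::
    "'k::field \<Rightarrow> 'k \<Rightarrow> 'k \<Rightarrow> 'k \<Rightarrow> 'k \<Rightarrow> 'k \<Rightarrow> 'k
      \<Rightarrow> (bool + (bool list \<Rightarrow> bool list), 'k) nc_poly" where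
  "nucleus_sum e a a' c c' d d' = B.combination
     [(e, [], id), (a, [], basilica_a), (a', [], basilica_a_inv),
      (c, [], basilica_c), (c', [], basilica_c_inv),
      (d, [], basilica_a \<circ> basilica_c_inv), (d', [], basilica_c \<circ> basilica_a_inv)]"

text \<open>A corner keeps the coefficients of those elements that send \<open>x\<close> to \<open>y\<close> and adds up those with
  the same section.  The coefficients \<open>e\<close>, \<open>a\<close>, \<open>a'\<close> belong to the elements
  that fix both letters, the other four to those that exchange the letters.\<close>

lemma nucleus_sum_corners:
  "B.nek_cong (adj (letter_gen True) * nucleus_sum e a a' c c' d d' * letter_gen True)
     (nucleus_sum e 0 0 a a' 0 0)"
  "B.nek_cong (adj (letter_gen True) * nucleus_sum e a a' c c' d d' * letter_gen False)
     (nucleus_sum (c + d') 0 c' 0 0 0 d)"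
  "B.nek_cong (adj (letter_gen False) * nucleus_sum e a a' c c' d d' * letter_gen True)
     (nucleus_sum (c' + d) c 0 0 0 d' 0)"
proof -
  let ?L = "[(e, [], id), (a, [], basilica_a), (a', [], basilica_a_inv),
      (c, [], basilica_c), (c', [], basilica_c_inv),
      (d, [], basilica_a \<circ> basilica_c_inv), (d', [], basilica_c \<circ> basilica_a_inv)]"
  have corner: "B.nek_cong (adj (letter_gen y) * nucleus_sum e a a' c c' d d' * letter_gen x)
      (B.combination (B.strip_letter y (B.push_letter x ?L)))" for x y
    unfolding nucleus_sum_def by (rule B.corner_combination) (simp add: in_basilica)
  show "B.nek_cong (adj (letter_gen True) * nucleus_sum e a a' c c' d d' * letter_gen True)
     (nucleus_sum e 0 0 a a' 0 0)"
    using corner[of True True]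
    by (simp add: nucleus_sum_def B.strip_letter_def B.push_letter_def basilica_sections_simps
        B.monomial_simps)
  show "B.nek_cong (adj (letter_gen True) * nucleus_sum e a a' c c' d d' * letter_gen False)
     (nucleus_sum (c + d') 0 c' 0 0 0 d)"
    using corner[of True False]
    by (simp add: nucleus_sum_def B.strip_letter_def B.push_letter_def basilica_sections_simps
        B.monomial_simps(5) add_ac flip: B.monomial_simps(4))
  show "B.nek_cong (adj (letter_gen False) * nucleus_sum e a a' c c' d d' * letter_gen True)
     (nucleus_sum (c' + d) c 0 0 0 d' 0)"
    using corner[of False True]
    by (simp add: nucleus_sum_def B.strip_letter_def B.push_letter_def basilica_sections_simps
        B.monomial_simps(5) add_ac flip: B.monomial_simps(4))
qed

lemma nucleus_sum_in_carrier: "nucleus_sum e a a' c c' d d' \<in> B.nek_carrier"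
  unfolding nucleus_sum_def by (rule B.combination_in_carrier) (simp add: in_basilica)

lemma compresses_via_corner:
  assumes "B.nek_cong (adj (letter_gen y) * nucleus_sum e a a' c c' d d' * letter_gen x) q"
    and "B.compresses_to_scalar q"
  shows "B.compresses_to_scalar (nucleus_sum e a a' c c' d d')"
  using nucleus_sum_in_carrier
  by (rule B.compresses_to_scalar.corner) (rule B.compresses_to_scalar_cong[OF assms(2,1)])

text \<open>At the letter 1 the elements \<open>a\<close> and \<open>a\<^sup>-\<^sup>1\<close> have sections \<open>c\<close> and \<open>c\<^sup>-\<^sup>1\<close>, which move the next
  letter; the second corner removes these.\<close>

lemma compresses_scalar_part:
  assumes "e \<noteq> 0"
  shows "B.compresses_to_scalar (nucleus_sum e a a' c c' d d')"
proof -
  have "nucleus_sum e 0 0 0 0 0 0 = B.monomial e [] \<one>\<^bsub>basilica\<^esub>"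
    by (simp add: nucleus_sum_def B.monomial_simps one_basilica)
  then have "B.compresses_to_scalar (nucleus_sum e 0 0 0 0 0 0)"
    using B.compresses_to_scalar.scalar[OF assms]
      B.nek_cong_refl[OF nucleus_sum_in_carrier[of e 0 0 0 0 0 0]] by simp
  then have "B.compresses_to_scalar (nucleus_sum e 0 0 a a' 0 0)"
    by (rule compresses_via_corner[OF nucleus_sum_corners(1)])
  then show ?thesis
    by (rule compresses_via_corner[OF nucleus_sum_corners(1)])
qed

text \<open>If \<open>e = 0\<close>, the corner at 1 and 1 replaces \<open>a\<close>, \<open>a\<^sup>-\<^sup>1\<close> by \<open>c\<close>, \<open>c\<^sup>-\<^sup>1\<close>.  Of these, \<open>c\<close> has the section 1
  at the letter 0 and \<open>c\<^sup>-\<^sup>1\<close> has it at 1, so each of the two coefficients is the scalar part of a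
  suitable further corner.\<close>

lemma compresses_a_part:
  assumes "e \<noteq> 0 \<or> a \<noteq> 0 \<or> a' \<noteq> 0"
  shows "B.compresses_to_scalar (nucleus_sum e a a' c c' d d')"
proof -
  have "B.compresses_to_scalar (nucleus_sum e 0 0 a a' 0 0)"
  proof (cases "a = 0")
    case False
    then show ?thesis
      by (intro compresses_via_corner[OF nucleus_sum_corners(2) compresses_scalar_part]) simp
  next
    case a: True
    show ?thesis
    proof (cases "a' = 0")
      case False
      then show ?thesis
        by (intro compresses_via_corner[OF nucleus_sum_corners(3) compresses_scalar_part]) simp
    qed (use a assms in \<open>simp add: compresses_scalar_part\<close>)
  qed
  then show ?thesis by (rule compresses_via_corner[OF nucleus_sum_corners(1)])
qed

text \<open>The two corners that exchange the letters have the coefficients \<open>c + d'\<close>, \<open>c'\<close> and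
  \<open>c' + d\<close>, \<open>c\<close> at elements that fix both letters; if these four vanish, so do \<open>c\<close>, \<open>c'\<close>, \<open>d\<close>, \<open>d'\<close>.\<close>

lemma compresses_nucleus_sum:
  assumes "\<not> (e = 0 \<and> a = 0 \<and> a' = 0 \<and> c = 0 \<and> c' = 0 \<and> d = 0 \<and> d' = 0)"
  shows "B.compresses_to_scalar (nucleus_sum e a a' c c' d d')"
proof -
  consider "e \<noteq> 0 \<or> a \<noteq> 0 \<or> a' \<noteq> 0" | "c + d' \<noteq> 0 \<or> c' \<noteq> 0" | "c' + d \<noteq> 0 \<or> c \<noteq> 0"
    using assms by (cases "c = 0"; cases "c' = 0"; auto)
  then show ?thesis
  proof cases
    case 1
    then show ?thesis by (rule compresses_a_part)
  next
    case 2
    then show ?thesis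
      by (intro compresses_via_corner[OF nucleus_sum_corners(2) compresses_a_part]) auto
  next
    case 3
    then show ?thesis
      by (intro compresses_via_corner[OF nucleus_sum_corners(3) compresses_a_part]) auto
  qed
qed

theorem theorem6p1:
  shows "simple_algebra (nekrashevych_algebra TYPE('k::field) basilica (\<lambda>g. g))"
proof (rule B.simple_nekrashevych_algebra)
  show "set basilica_nucleus \<subseteq> carrier basilica" by (rule nucleus_in_basilica)
  show "\<And>g x. g \<in> set basilica_nucleus \<Longrightarrow> sect g x \<in> set basilica_nucleus"
    by (rule nucleus_closed)
  show "\<And>g. g \<in> carrier basilica \<Longrightarrow> \<exists>n. B.sections_reach (set basilica_nucleus) n g"
    by (rule basilica_contracting)
  fix E :: "('k \<times> bool list \<times> (bool list \<Rightarrow> bool list)) list"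
  assume E: "B.groups_in (set basilica_nucleus) E" "\<And>k u g. (k, u, g) \<in> set E \<Longrightarrow> u = []"
    "B.combination E \<notin> B.nek_ideal"
  obtain \<kappa> where "B.combination E
      = (\<Sum>i < length basilica_nucleus. B.monomial (\<kappa> i) [] (basilica_nucleus ! i))"
    using B.combination_of_group_elements[OF E(1)] E(2) by blast
  also have "\<dots> = nucleus_sum (\<kappa> 0) (\<kappa> 1) (\<kappa> 2) (\<kappa> 3) (\<kappa> 4) (\<kappa> 5) (\<kappa> 6)"
    by (simp add: basilica_nucleus_def nucleus_sum_def eval_nat_numeral lessThan_Suc add_ac)
  finally have sum: "B.combination E
      = nucleus_sum (\<kappa> 0) (\<kappa> 1) (\<kappa> 2) (\<kappa> 3) (\<kappa> 4) (\<kappa> 5) (\<kappa> 6)" .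
  have "nucleus_sum 0 0 0 0 0 0 0 = (0 :: (bool + (bool list \<Rightarrow> bool list), 'k) nc_poly)"
    by (simp add: nucleus_sum_def B.monomial_simps)
  then show "B.compresses_to_scalar (B.combination E)"
    using E(3) B.nek_ideal_closed(1) unfolding sum by (intro compresses_nucleus_sum) auto
qed

end
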